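(* Consider the problem of minimizing $$\mathcal F_\epsilon(\gamma_1,\dots,\gamma_p)=\sum_{i=1}^p\lambda_i\left[\int_{X_i\times Y}c_i\,d\gamma_i+\epsilon\,\mathrm{KL}(\gamma_i\mid\xi_i)\right]$$ over all $\nu\in\mathcal P(Y)$ and all tuples $(\gamma_1,\dots,\gamma_p)$ with $\gamma_i\in\Pi(\nu_i,\nu)$ for $i=1,\dots,p$. This problem has a unique optimal tuple $(\gamma_{1,\epsilon},\dots,\gamma_{p,\epsilon})$. Its common second marginal $\nu_\epsilon$ is the unique barycenter, i.e. the unique $\nu\in\mathcal P(Y)$ that is the common second marginal of a minimizing tuple.
   Context: Setting. Let $p\ge 2$ and $\epsilon>0$. Let $X_1,\dots,X_p$ and $Y$ be compact metric spaces; $\mathcal P(Z)$ denotes the Borel probability measures on $Z$ and $C(Z)$ the real-valued continuous functions on $Z$. For each $i$, let $\nu_i\in\mathcal P(X_i)$, $c_i\in C(X_i\times Y)$, and $\lambda_i>0$ with $\sum_{i=1}^p\lambda_i=1$. Fix $\eta\in\mathcal P(Y)$. Standing assumption: $\operatorname{spt}\nu_i=X_i$ for all $i$ and $\operatorname{spt}\eta=Y$. Set $\xi_i:=\nu_i\otimes\eta$ (product measure). $\Pi(\mu,\nu)$ is the set of Borel probability measures on the product space with first marginal $\mu$ and second marginal $\nu$. For probability measures $\gamma,\xi$, $\mathrm{KL}(\gamma\mid\xi):=\int\log\left(\frac{d\gamma}{d\xi}\right)d\gamma$ if $\gamma\ll\xi$ and $+\infty$ otherwise (with $0\log 0=0$).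 *)

theory Defs
  imports "HOL-Probability.Probability"
begin

definition borel_of :: "'a topology \<Rightarrow> 'a measure" where
  "borel_of T = sigma (topspace T) {U. openin T U}"

definition borel_probs :: "'a topology \<Rightarrow> 'a measure set" where
  "borel_probs T = {\<mu>. prob_space \<mu> \<and> sets \<mu> = sets (borel_of T)}"

definition spt :: "'a topology \<Rightarrow> 'a measure \<Rightarrow> 'a set" where
  "spt T \<mu> = {x \<in> topspace T. \<forall>U. openin T U \<and> x \<in> U \<longrightarrow> emeasure \<mu> U > 0}"

definition couplings ::
    "'a topology \<Rightarrow> 'b topology \<Rightarrow> 'a measure \<Rightarrow> 'b measure \<Rightarrow> ('a \<times> 'b) measure set" where
  "couplings S T \<mu> \<nu> =
     {\<gamma> \<in> borel_probs (prod_topology S T).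
        distr \<gamma> (borel_of S) fst = \<mu> \<and> distr \<gamma> (borel_of T) snd = \<nu>}"

text \<open>The Bochner integral is real-valued and returns 0 for non-integrable functions. The
  integral in the relative entropy can be \<open>+\<infinity>\<close> even when \<open>\<gamma>\<close> is absolutely continuous, so it
  is taken here as positive part minus negative part (\<^const>\<open>ennreal\<close> maps negative reals
  to 0). For probability measures the negative part of the entropy integral is at most
  \<open>1/e\<close>, so \<open>\<infinity> - \<infinity>\<close> does not arise.\<close>

definition ereal_integral :: "'a measure \<Rightarrow> ('a \<Rightarrow> real) \<Rightarrow> ereal" where
  "ereal_integral M f =
     enn2ereal (\<integral>\<^sup>+ x. ennreal (f x) \<partial>M) - enn2ereal (\<integral>\<^sup>+ x. ennreal (- f x) \<partial>M)"

definition KL :: "'a measure \<Rightarrow> 'a measure \<Rightarrow> ereal" where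
  "KL \<gamma> \<xi> =
     (if absolutely_continuous \<xi> \<gamma>
      then ereal_integral \<gamma> (\<lambda>z. ln (enn2real (RN_deriv \<xi> \<gamma> z)))
      else \<infinity>)"

text \<open>The product measure lives on the product \<open>\<sigma>\<close>-algebra, the couplings on the Borel
  \<open>\<sigma>\<close>-algebra of the product topology; the two agree for compact metric spaces, which are
  second countable.\<close>

definition objective ::
    "nat \<Rightarrow> real \<Rightarrow> (nat \<Rightarrow> real) \<Rightarrow> (nat \<Rightarrow> 'a \<times> 'b \<Rightarrow> real) \<Rightarrow>
     (nat \<Rightarrow> 'a measure) \<Rightarrow> 'b measure \<Rightarrow> (nat \<Rightarrow> ('a \<times> 'b) measure) \<Rightarrow> ereal" where
  "objective p \<epsilon> lam c \<nu> \<eta> \<gamma> =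
     (\<Sum>i = 1..p. ereal (lam i) *
        (ereal (\<integral>z. c i z \<partial>\<gamma> i) + ereal \<epsilon> * KL (\<gamma> i) (\<nu> i \<Otimes>\<^sub>M \<eta>)))"

text \<open>The spaces \<open>X i\<close> share a carrier type, but each has its own underlying set and metric;
  arbitrary families fit after passing to a disjoint union.
  Tuples indexed by \<open>{1..p}\<close> are extensional functions, so that equality of functions is
  equality of tuples.\<close>

definition feasible ::
    "nat \<Rightarrow> (nat \<Rightarrow> 'a metric) \<Rightarrow> 'b metric \<Rightarrow> (nat \<Rightarrow> 'a measure) \<Rightarrow>
     (nat \<Rightarrow> ('a \<times> 'b) measure) set" where
  "feasible p X Y \<nu> =
     (\<Union>\<mu> \<in> borel_probs (mtopology_of Y).
        \<Pi>\<^sub>E i \<in> {1..p}. couplings (mtopology_of (X i)) (mtopology_of Y) (\<nu> i) \<mu>)"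

definition optimal ::
    "nat \<Rightarrow> real \<Rightarrow> (nat \<Rightarrow> 'a metric) \<Rightarrow> 'b metric \<Rightarrow> (nat \<Rightarrow> real) \<Rightarrow>
     (nat \<Rightarrow> 'a \<times> 'b \<Rightarrow> real) \<Rightarrow> (nat \<Rightarrow> 'a measure) \<Rightarrow> 'b measure \<Rightarrow>
     (nat \<Rightarrow> ('a \<times> 'b) measure) \<Rightarrow> bool" where
  "optimal p \<epsilon> X Y lam c \<nu> \<eta> \<gamma> \<longleftrightarrow>
     \<gamma> \<in> feasible p X Y \<nu> \<and>
     (\<forall>\<gamma>' \<in> feasible p X Y \<nu>. objective p \<epsilon> lam c \<nu> \<eta> \<gamma> \<le> objective p \<epsilon> lam c \<nu> \<eta> \<gamma>')"

definition common_snd_marginal ::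
    "nat \<Rightarrow> 'b metric \<Rightarrow> (nat \<Rightarrow> ('a \<times> 'b) measure) \<Rightarrow> 'b measure \<Rightarrow> bool" where
  "common_snd_marginal p Y \<gamma> \<mu> \<longleftrightarrow>
     (\<forall>i \<in> {1..p}. distr (\<gamma> i) (borel_of (mtopology_of Y)) snd = \<mu>)"

definition barycenter ::
    "nat \<Rightarrow> real \<Rightarrow> (nat \<Rightarrow> 'a metric) \<Rightarrow> 'b metric \<Rightarrow> (nat \<Rightarrow> real) \<Rightarrow>
     (nat \<Rightarrow> 'a \<times> 'b \<Rightarrow> real) \<Rightarrow> (nat \<Rightarrow> 'a measure) \<Rightarrow> 'b measure \<Rightarrow> 'b measure \<Rightarrow> bool" where
  "barycenter p \<epsilon> X Y lam c \<nu> \<eta> \<mu> \<longleftrightarrow>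
     \<mu> \<in> borel_probs (mtopology_of Y) \<and>
     (\<exists>\<gamma>. optimal p \<epsilon> X Y lam c \<nu> \<eta> \<gamma> \<and> common_snd_marginal p Y \<gamma> \<mu>)"

end

theory Submission imports Defs begin

text \<open>
  Tuples of finite objective consist of densities with respect to the \<open>\<xi>\<^sub>i\<close>, on which the objective
  is an integral of a linear term plus \<open>u ln u\<close>. The midpoint convexity defect of \<open>u ln u\<close> dominates
  \<open>(\<surd>a - \<surd>b)\<^sup>2 / 2\<close>, and hence controls the \<open>L\<^sup>1\<close> distance of two competitors. So a minimizing sequence
  is Cauchy in \<open>L\<^sup>1\<close>, which gives a limit without any weak compactness: the marginal constraints
  are linear and \<open>L\<^sup>1\<close>-closed, and Fatou's lemma gives lower semicontinuity. The same defect
  vanishes for two minimizers, so their densities agree almost everywhere.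
\<close>

text \<open>The common second marginal is itself an unknown, which makes feasibility an existential
  statement. Comparing every second marginal with the one of index 1 removes the quantifier and
  leaves equations that are linear in the densities, one for each measurable set.

  The defect controls the \<open>L^1\<close> distance \<open>d\<close> through a free parameter
  \<open>t > 0\<close>: it is at least a constant times \<open>t * (d - 2 * t)\<close>. This form is
  linear in \<open>d\<close>, so it follows by integrating a pointwise inequality, with no
  Cauchy-Schwarz step. In a minimizing sequence of accuracy \<open>(1/4)^n\<close> the choice
  \<open>t = (1/2)^n\<close> yields \<open>L^1\<close> steps of order \<open>(1/2)^n\<close>. These
  are summable, so the whole sequence converges almost everywhere as well as in \<open>L^1\<close>,
  and Fatou's lemma applies to it directly.

  Hence every optimal tuple has finite value and is given by densities.\<close>

section \<open>The entropy function\<close>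

text \<open>The junk value of \<open>ln 0\<close> is harmless: \<open>ent 0 = 0\<close>.\<close>

definition ent :: "real \<Rightarrow> real" where
  "ent x = x * ln x"

lemma borel_measurable_ent [measurable]: "ent \<in> borel_measurable borel"
  unfolding ent_def by measurable

text \<open>This is \<open>ln y <= y - 1\<close> at \<open>y = 1 / x\<close>, multiplied by
  \<open>x\<close>. It is the source of the lower bound -1 that keeps negative parts of entropy
  integrals finite.\<close>

lemma ent_ge_linear:
  assumes "0 \<le> x"
  shows "x - 1 \<le> ent x"
proof (cases "x = 0")
  case False
  then have "0 < x" using assms by simp
  then have "ln (1 / x) \<le> 1 / x - 1" by (intro ln_le_minus_one) simp
  then have "1 - 1 / x \<le> ln x" using \<open>0 < x\<close> by (simp add: ln_div)
  then have "x * (1 - 1 / x) \<le> x * ln x"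
    using \<open>0 < x\<close> by (intro mult_left_mono) auto
  moreover have "x * (1 - 1 / x) = x - 1" using \<open>0 < x\<close> by (simp add: field_simps)
  ultimately show ?thesis by (simp add: ent_def)
qed (simp add: ent_def)

lemma ent_ge_minus_one: "0 \<le> x \<Longrightarrow> - 1 \<le> ent x"
  using ent_ge_linear[of x] by simp

text \<open>Continuity up to the boundary point 0 matters, because a limit of densities may vanish
  on a set of positive measure. There it amounts to \<open>x * ln x\<close> tending to 0 from the
  right.\<close>

lemma continuous_on_ent: "continuous_on {0..} ent"
proof -
  have "(ent \<longlongrightarrow> ent x) (at x within {0..})" if "0 \<le> x" for x
  proof (cases "x = 0")
    case True
    have "((\<lambda>x::real. x * ln x) \<longlongrightarrow> 0) (at_right 0)" by real_asymp
    then show ?thesis using True by (simp add: ent_def[abs_def] at_within_Ici_at_right)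
  next
    case False
    then have "isCont (\<lambda>x. x * ln x) x" by (intro continuous_intros) auto
    then show ?thesis
      unfolding ent_def[abs_def] isCont_def using tendsto_within_subset by blast
  qed
  then show ?thesis by (auto simp: continuous_on_def)
qed

lemma tendsto_ent:
  assumes "u \<longlonglongrightarrow> x" "\<And>n. 0 \<le> u n" "0 \<le> x"
  shows "(\<lambda>n. ent (u n)) \<longlonglongrightarrow> ent x"
  using continuous_on_tendsto_compose[OF continuous_on_ent assms(1)] assms(2,3) by simp

text \<open>A pointwise form of the bound of relative entropy by Hellinger distance: the left side
  equals \<open>(sqrt a - sqrt m)^2 + (a - m)\<close>. The asymmetric part \<open>a - m\<close>
  cancels once the inequality is added to the one for \<open>b\<close>, with \<open>m\<close> the
  mean of \<open>a\<close> and \<open>b\<close>.\<close>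

lemma ent_relative_ge:
  assumes "0 \<le> a" "0 < m"
  shows "2 * a - 2 * (sqrt a * sqrt m) \<le> ent a - a * ln m"
proof (cases "a = 0")
  case False
  then have "0 < a" using assms by simp
  define z where "z = sqrt m / sqrt a"
  \<comment> \<open>Taking the square root before using \<open>ln z \<le> z - 1\<close> keeps a quadratic remainder.\<close>
  have "ln z \<le> z - 1"
    using \<open>0 < a\<close> \<open>0 < m\<close> by (intro ln_le_minus_one) (simp add: z_def)
  moreover have "ln z = (ln m - ln a) / 2"
    using \<open>0 < a\<close> \<open>0 < m\<close> by (simp add: z_def ln_div ln_sqrt)
  ultimately have "ln m - ln a \<le> 2 * (z - 1)" by (simp add: field_simps)
  then have "a * (ln m - ln a) \<le> a * (2 * (z - 1))"
    using \<open>0 < a\<close> by (intro mult_left_mono) auto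
  moreover have "a * z = sqrt a * sqrt m"
    unfolding z_def using \<open>0 < a\<close> by (metis real_div_sqrt times_divide_eq_left times_divide_eq_right less_imp_le)
  ultimately show ?thesis by (simp add: ent_def algebra_simps)
qed (simp add: ent_def)

lemma ent_midpoint_gap_sqrt:
  assumes "0 \<le> a" "0 \<le> b"
  shows "(sqrt a - sqrt b)\<^sup>2 / 2 \<le> ent a + ent b - 2 * ent ((a + b) / 2)"
proof (cases "a + b = 0")
  case True
  then show ?thesis using assms by (simp add: ent_def add_nonneg_eq_0_iff)
next
  case False
  define m where "m = (a + b) / 2"
  have m: "0 < m" using False assms by (simp add: m_def)
  have "2 * ent m = a * ln m + b * ln m" by (simp add: ent_def m_def field_simps)
  then have "2 * a - 2 * (sqrt a * sqrt m) + (2 * b - 2 * (sqrt b * sqrt m))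
      \<le> ent a + ent b - 2 * ent m"
    using ent_relative_ge[OF assms(1) m] ent_relative_ge[OF assms(2) m] by linarith
  moreover have "(sqrt a - sqrt b)\<^sup>2 / 2
      \<le> 2 * a - 2 * (sqrt a * sqrt m) + (2 * b - 2 * (sqrt b * sqrt m))"
  proof -
    define u v w where "u = sqrt a" and "v = sqrt b" and "w = sqrt m"
    \<comment> \<open>With \<open>2 * w^2 = u^2 + v^2\<close> the right-hand side is
      \<open>(u - w)^2 + (v - w)^2\<close>, which exceeds \<open>(u - v)^2 / 2\<close> by exactly
      half of this square.\<close>
    have "0 \<le> (2 * w - (u + v))\<^sup>2" by simp
    then have "4 * (u * w) + 4 * (v * w) \<le> 4 * w\<^sup>2 + u\<^sup>2 + v\<^sup>2 + 2 * (u * v)"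
      by (simp add: power2_eq_square algebra_simps)
    moreover have "u\<^sup>2 = a" "v\<^sup>2 = b" "4 * w\<^sup>2 = 2 * a + 2 * b"
      using assms m by (auto simp: u_def v_def w_def m_def)
    ultimately show ?thesis
      unfolding u_def[symmetric] v_def[symmetric] w_def[symmetric] power2_diff
      by (simp add: field_simps)
  qed
  ultimately show ?thesis by (simp add: m_def)
qed

lemma ent_midpoint: "0 \<le> a \<Longrightarrow> 0 \<le> b \<Longrightarrow> 2 * ent ((a + b) / 2) \<le> ent a + ent b"
  using ent_midpoint_gap_sqrt[of a b] zero_le_power2[of "sqrt a - sqrt b"] by linarith

text \<open>Factor \<open>\<bar>a - b\<bar> = x * y\<close> with \<open>x\<close> the distance and
  \<open>y\<close> the sum of the square roots. Then
  \<open>t * x * y <= x^2 / 2 + t^2 * y^2 / 2\<close>, and \<open>y^2 <= 2 * (a + b)\<close>. The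
  parameter \<open>t\<close> is kept free so that it can be adapted to the size of the defect after
  integration.\<close>

lemma ent_midpoint_gap:
  assumes "0 \<le> a" "0 \<le> b" "0 < t"
  shows "t * (\<bar>a - b\<bar> - t * (a + b)) \<le> ent a + ent b - 2 * ent ((a + b) / 2)"
proof -
  define x y where "x = \<bar>sqrt a - sqrt b\<bar>" and "y = sqrt a + sqrt b"
  have ab: "a = (sqrt a)\<^sup>2" "b = (sqrt b)\<^sup>2" using assms by auto
  have "a - b = (sqrt a - sqrt b) * y"
    by (subst (1) ab(1), subst (1) ab(2)) (simp add: y_def power2_eq_square algebra_simps)
  then have xy: "\<bar>a - b\<bar> = x * y" using assms by (simp add: abs_mult x_def y_def)
  have "y\<^sup>2 \<le> 2 * (a + b)"
  proof -
    have "0 \<le> (sqrt a - sqrt b)\<^sup>2" by simp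
    then show ?thesis using ab by (simp add: y_def power2_eq_square algebra_simps)
  qed
  then have "t * t * y\<^sup>2 \<le> t * t * (2 * (a + b))"
    using assms by (intro mult_left_mono) auto
  moreover have "0 \<le> (x - t * y)\<^sup>2" by simp
  ultimately have "t * (x * y - t * (a + b)) \<le> x\<^sup>2 / 2"
    by (simp add: power2_eq_square algebra_simps)
  also have "x\<^sup>2 / 2 \<le> ent a + ent b - 2 * ent ((a + b) / 2)"
    using ent_midpoint_gap_sqrt[OF assms(1,2)] by (simp add: x_def)
  finally show ?thesis by (simp add: xy)
qed

text \<open>Nonnegativity is required at every point and not only almost everywhere, so the
  pointwise entropy inequalities apply without exceptional sets.\<close>

definition entropic_density :: "'a measure \<Rightarrow> ('a \<Rightarrow> real) \<Rightarrow> bool" where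
  "entropic_density M f \<longleftrightarrow> (\<forall>x. 0 \<le> f x) \<and> integrable M f \<and> (\<integral>x. f x \<partial>M) = 1 \<and>
     integrable M (\<lambda>x. ent (f x))"

lemma entropic_densityD:
  assumes "entropic_density M f"
  shows "0 \<le> f x" "integrable M f" "(\<integral>x. f x \<partial>M) = 1" "integrable M (\<lambda>x. ent (f x))"
    "f \<in> borel_measurable M"
  using assms by (auto simp: entropic_density_def)

text \<open>Convexity bounds the entropy of the midpoint from above by the two given entropies. From
  below it is at least -1, which is integrable since the measure is finite.\<close>

lemma entropic_density_midpoint:
  assumes f: "entropic_density M f" and g: "entropic_density M g" and "finite_measure M"
  shows "entropic_density M (\<lambda>x. (f x + g x) / 2)"
proof -
  interpret finite_measure M by fact
  note fD = entropic_densityD[OF f] and gD = entropic_densityD[OF g]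
  note [measurable] = fD(5) gD(5)
  have "integrable M (\<lambda>x. ent ((f x + g x) / 2))"
  proof (rule Bochner_Integration.integrable_bound[of M "\<lambda>x. \<bar>ent (f x)\<bar> + \<bar>ent (g x)\<bar> + 1"])
    show "integrable M (\<lambda>x. \<bar>ent (f x)\<bar> + \<bar>ent (g x)\<bar> + 1)" using fD gD by auto
    have "\<bar>ent ((f x + g x) / 2)\<bar> \<le> \<bar>ent (f x)\<bar> + \<bar>ent (g x)\<bar> + 1" for x
      using ent_midpoint[OF fD(1)[of x] gD(1)[of x]] ent_ge_minus_one[of "(f x + g x) / 2"]
        fD(1)[of x] gD(1)[of x] by (simp add: abs_le_iff; linarith)
    then show "AE x in M. norm (ent ((f x + g x) / 2)) \<le> norm (\<bar>ent (f x)\<bar> + \<bar>ent (g x)\<bar> + 1)"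
      by (intro AE_I2) simp
  qed measurable
  then show ?thesis using fD gD by (auto simp: entropic_density_def)
qed

section \<open>Minimizing entropic functionals over tuples of densities\<close>

lemma L1_fast_Cauchy_limit:
  fixes F :: "nat \<Rightarrow> 'a \<Rightarrow> real"
  assumes int: "\<And>n. integrable M (F n)" and nonneg: "\<And>n x. 0 \<le> F n x"
    and summ: "summable (\<lambda>n. \<integral>x. \<bar>F n x - F (Suc n) x\<bar> \<partial>M)"
  shows "\<exists>f. (\<forall>x. 0 \<le> f x) \<and> integrable M f \<and> (AE x in M. (\<lambda>n. F n x) \<longlonglongrightarrow> f x) \<and>
    (\<lambda>n. \<integral>x. \<bar>F n x - f x\<bar> \<partial>M) \<longlonglongrightarrow> 0"
proof -
  have [measurable]: "F n \<in> borel_measurable M" for n using int by auto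
  define d where "d n x = \<bar>F n x - F (Suc n) x\<bar>" for n x
  have d_int: "integrable M (d n)" for n unfolding d_def using int by auto
  have d_nonneg: "0 \<le> d n x" for n x by (simp add: d_def)
  have [measurable]: "d n \<in> borel_measurable M" for n using d_int by auto
  have summ_d: "summable (\<lambda>n. \<integral>x. d n x \<partial>M)" using summ by (simp add: d_def)
  have "(\<integral>\<^sup>+x. (\<Sum>n. ennreal (d n x)) \<partial>M) = (\<Sum>n. \<integral>\<^sup>+x. ennreal (d n x) \<partial>M)"
    by (intro nn_integral_suminf) measurable
  also have "\<dots> = (\<Sum>n. ennreal (\<integral>x. d n x \<partial>M))"
    using d_int d_nonneg by (intro suminf_cong nn_integral_eq_integral) auto
  also have "\<dots> = ennreal (\<Sum>n. \<integral>x. d n x \<partial>M)"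
    using summ_d d_nonneg by (intro suminf_ennreal2) auto
  finally have "(\<integral>\<^sup>+x. (\<Sum>n. ennreal (d n x)) \<partial>M) \<noteq> \<infinity>" by simp
  then have "AE x in M. (\<Sum>n. ennreal (d n x)) \<noteq> \<infinity>"
    by (intro nn_integral_PInf_AE) auto
  then have AE_summ: "AE x in M. summable (\<lambda>n. d n x)"
    by eventually_elim (intro summable_suminf_not_top, auto simp: d_nonneg)
  \<comment> \<open>An integrable majorant of all \<open>F n\<close> at once, for dominated
    convergence.\<close>
  define w where "w x = F 0 x + (\<Sum>n. d n x)" for x
  have w_int: "integrable M w"
    unfolding w_def using AE_summ summ_d d_int int d_nonneg
    by (intro Bochner_Integration.integrable_add integrable_suminf) auto
  \<comment> \<open>Where the sequence diverges, \<open>lim\<close> is unspecified. Clipping at 0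
    makes the limit nonnegative everywhere and changes nothing at points of convergence.\<close>
  define f where "f x = max 0 (lim (\<lambda>n. F n x))" for x
  have [measurable]: "f \<in> borel_measurable M" unfolding f_def by measurable
  have *: "(\<lambda>n. F n x) \<longlonglongrightarrow> f x \<and> (\<forall>n. F n x \<le> w x)" if "summable (\<lambda>n. d n x)" for x
  proof
    have "summable (\<lambda>n. F (Suc n) x - F n x)"
      using that by (intro summable_rabs_cancel[of "\<lambda>n. F (Suc n) x - F n x"])
        (simp add: d_def abs_minus_commute)
    then have "(\<lambda>n. \<Sum>k<n. F (Suc k) x - F k x) \<longlonglongrightarrow> (\<Sum>n. F (Suc n) x - F n x)"
      by (rule summable_LIMSEQ)
    then have "(\<lambda>n. F n x - F 0 x) \<longlonglongrightarrow> (\<Sum>n. F (Suc n) x - F n x)"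
      by (simp add: sum_lessThan_telescope[of "\<lambda>k. F k x"])
    from tendsto_add[OF this tendsto_const[of "F 0 x"]]
    have conv: "(\<lambda>n. F n x) \<longlonglongrightarrow> (\<Sum>n. F (Suc n) x - F n x) + F 0 x" by simp
    then have "0 \<le> (\<Sum>n. F (Suc n) x - F n x) + F 0 x"
      using nonneg by (intro LIMSEQ_le_const) auto
    then show "(\<lambda>n. F n x) \<longlonglongrightarrow> f x" using conv limI[OF conv] by (simp add: f_def)
    show "\<forall>n. F n x \<le> w x"
    proof
      fix n
      have "F n x - F 0 x = (\<Sum>k<n. F (Suc k) x - F k x)" by (simp add: sum_lessThan_telescope[of "\<lambda>k. F k x"])
      also have "\<dots> \<le> (\<Sum>k<n. d k x)" by (intro sum_mono) (simp add: d_def)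
      also have "\<dots> \<le> (\<Sum>k. d k x)" using that d_nonneg by (intro sum_le_suminf) auto
      finally show "F n x \<le> w x" by (simp add: w_def)
    qed
  qed
  have lim: "AE x in M. (\<lambda>n. F n x) \<longlonglongrightarrow> f x" using AE_summ * by auto
  have bound: "AE x in M. norm (F n x) \<le> w x" for n
    using AE_summ by eventually_elim (simp add: * nonneg)
  have f_int: "integrable M f"
    by (rule integrable_dominated_convergence[OF _ _ w_int lim bound]) auto
  have "(\<lambda>n. \<integral>x. \<bar>F n x - f x\<bar> \<partial>M) \<longlonglongrightarrow> (\<integral>x. 0 \<partial>M)"
  proof (rule integral_dominated_convergence)
    show "integrable M (\<lambda>x. w x + f x)" using w_int f_int by auto
    show "AE x in M. (\<lambda>n. \<bar>F n x - f x\<bar>) \<longlonglongrightarrow> 0"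
      using lim by eventually_elim (simp add: tendsto_rabs_zero_iff LIM_zero_iff)
    show "AE x in M. norm \<bar>F n x - f x\<bar> \<le> w x + f x" for n
      using bound[of n]
    proof eventually_elim
      case (elim x)
      have "0 \<le> F n x" "0 \<le> f x" using nonneg by (auto simp: f_def)
      then show ?case using elim by (simp add: abs_le_iff)
    qed
  qed measurable
  then show ?thesis using f_int lim by (intro exI[of _ f] conjI) (auto simp: f_def)
qed

text \<open>Only midpoints are needed from convexity. The closedness assumption may presuppose that
  the limit has finite entropy, since lower semicontinuity supplies this; what remains to be checked
  in an instance is the stability of the constraints.\<close>

locale entropy_minimization =
  fixes I :: "'i set" and \<xi> :: "'i \<Rightarrow> 'a measure" and c :: "'i \<Rightarrow> 'a \<Rightarrow> real"
    and lam :: "'i \<Rightarrow> real" and \<epsilon> B :: real and K :: "('i \<Rightarrow> 'a \<Rightarrow> real) set"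
  assumes finite_I: "finite I" and \<epsilon>_pos: "0 < \<epsilon>"
    and prob: "\<And>i. i \<in> I \<Longrightarrow> prob_space (\<xi> i)"
    and c_meas: "\<And>i. i \<in> I \<Longrightarrow> c i \<in> borel_measurable (\<xi> i)"
    and c_bound: "\<And>i x. i \<in> I \<Longrightarrow> x \<in> space (\<xi> i) \<Longrightarrow> \<bar>c i x\<bar> \<le> B"
    and lam_pos: "\<And>i. i \<in> I \<Longrightarrow> 0 < lam i"
    and dens: "\<And>f i. f \<in> K \<Longrightarrow> i \<in> I \<Longrightarrow> entropic_density (\<xi> i) (f i)"
    and midpoint: "\<And>f g. f \<in> K \<Longrightarrow> g \<in> K \<Longrightarrow> (\<lambda>i x. (f i x + g i x) / 2) \<in> K"
    and L1_closed: "\<And>F f. (\<And>n. F n \<in> K) \<Longrightarrow>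
      (\<And>i. i \<in> I \<Longrightarrow> entropic_density (\<xi> i) (f i)) \<Longrightarrow>
      (\<And>i. i \<in> I \<Longrightarrow> (\<lambda>n. \<integral>x. \<bar>F n i x - f i x\<bar> \<partial>\<xi> i) \<longlonglongrightarrow> 0) \<Longrightarrow> f \<in> K"
begin

definition cost :: "'i \<Rightarrow> ('a \<Rightarrow> real) \<Rightarrow> real" where
  "cost i f = (\<integral>x. c i x * f x \<partial>\<xi> i) + \<epsilon> * (\<integral>x. ent (f x) \<partial>\<xi> i)"

definition J :: "('i \<Rightarrow> 'a \<Rightarrow> real) \<Rightarrow> real" where
  "J f = (\<Sum>i\<in>I. lam i * cost i (f i))"

section \<open>Quantitative midpoint convexity of the objective\<close>

lemma integrable_cost:
  assumes "i \<in> I" "integrable (\<xi> i) f"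
  shows "integrable (\<xi> i) (\<lambda>x. c i x * f x)"
proof (rule Bochner_Integration.integrable_bound[of _ "\<lambda>x. B * f x"])
  note [measurable] = c_meas[OF assms(1)]
  have [measurable]: "f \<in> borel_measurable (\<xi> i)" using assms by auto
  show "(\<lambda>x. c i x * f x) \<in> borel_measurable (\<xi> i)" by measurable
  show "AE x in \<xi> i. norm (c i x * f x) \<le> norm (B * f x)"
    using c_bound[OF assms(1)] by (intro AE_I2) (force simp: abs_mult intro!: mult_right_mono)
qed (use assms in auto)

text \<open>The transport term is linear in the density and drops out of the midpoint defect; only
  the entropy remains.\<close>

lemma cost_gap_eq:
  assumes i: "i \<in> I" and f: "entropic_density (\<xi> i) f" and g: "entropic_density (\<xi> i) g"
  shows "cost i f + cost i g - 2 * cost i (\<lambda>x. (f x + g x) / 2)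
    = \<epsilon> * (\<integral>x. ent (f x) + ent (g x) - 2 * ent ((f x + g x) / 2) \<partial>\<xi> i)"
    and "integrable (\<xi> i) (\<lambda>x. ent (f x) + ent (g x) - 2 * ent ((f x + g x) / 2))"
proof -
  interpret prob_space "\<xi> i" by (rule prob[OF i])
  have h: "entropic_density (\<xi> i) (\<lambda>x. (f x + g x) / 2)"
    by (rule entropic_density_midpoint[OF f g finite_measure_axioms])
  note fD = entropic_densityD[OF f] and gD = entropic_densityD[OF g] and hD = entropic_densityD[OF h]
  show "integrable (\<xi> i) (\<lambda>x. ent (f x) + ent (g x) - 2 * ent ((f x + g x) / 2))"
    using fD(4) gD(4) hD(4) by simp
  have "(\<integral>x. c i x * ((f x + g x) / 2) \<partial>\<xi> i) = (\<integral>x. (c i x * f x + c i x * g x) / 2 \<partial>\<xi> i)"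
    by (simp add: distrib_left)
  also have "\<dots> = ((\<integral>x. c i x * f x \<partial>\<xi> i) + (\<integral>x. c i x * g x \<partial>\<xi> i)) / 2"
    using integrable_cost[OF i fD(2)] integrable_cost[OF i gD(2)] by simp
  finally show "cost i f + cost i g - 2 * cost i (\<lambda>x. (f x + g x) / 2)
    = \<epsilon> * (\<integral>x. ent (f x) + ent (g x) - 2 * ent ((f x + g x) / 2) \<partial>\<xi> i)"
    using fD(4) gD(4) hD(4) by (simp add: cost_def field_simps)
qed

text \<open>Integrating the pointwise bound turns \<open>t * (f x + g x)\<close> into
  \<open>2 * t\<close>, because both densities have mass 1.\<close>

lemma cost_gap:
  assumes i: "i \<in> I" and f: "entropic_density (\<xi> i) f" and g: "entropic_density (\<xi> i) g"
  shows "0 < t \<Longrightarrow> \<epsilon> * (t * ((\<integral>x. \<bar>f x - g x\<bar> \<partial>\<xi> i) - 2 * t))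
      \<le> cost i f + cost i g - 2 * cost i (\<lambda>x. (f x + g x) / 2)"
    and "0 \<le> cost i f + cost i g - 2 * cost i (\<lambda>x. (f x + g x) / 2)"
proof -
  note fD = entropic_densityD[OF f] and gD = entropic_densityD[OF g]
  note eq = cost_gap_eq[OF i f g]
  show "0 \<le> cost i f + cost i g - 2 * cost i (\<lambda>x. (f x + g x) / 2)"
    unfolding eq(1) using ent_midpoint[OF fD(1) gD(1)] \<epsilon>_pos
    by (intro mult_nonneg_nonneg Bochner_Integration.integral_nonneg) auto
  assume t: "0 < t"
  have "t * ((\<integral>x. \<bar>f x - g x\<bar> \<partial>\<xi> i) - 2 * t)
      = (\<integral>x. t * (\<bar>f x - g x\<bar> - t * (f x + g x)) \<partial>\<xi> i)"
    using fD(2,3) gD(2,3) by (simp add: algebra_simps)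
  also have "\<dots> \<le> (\<integral>x. ent (f x) + ent (g x) - 2 * ent ((f x + g x) / 2) \<partial>\<xi> i)"
    using ent_midpoint_gap[OF fD(1) gD(1) t] fD(2) gD(2)
    by (intro integral_mono eq(2)) auto
  finally show "\<epsilon> * (t * ((\<integral>x. \<bar>f x - g x\<bar> \<partial>\<xi> i) - 2 * t))
      \<le> cost i f + cost i g - 2 * cost i (\<lambda>x. (f x + g x) / 2)"
    unfolding eq(1) using \<epsilon>_pos by (intro mult_left_mono) auto
qed

text \<open>Every index contributes a nonnegative defect, so the defect of a single index is bounded
  by the weighted sum.\<close>

lemma J_gap:
  assumes f: "f \<in> K" and g: "g \<in> K" and i: "i \<in> I" and t: "0 < t"
  shows "lam i * \<epsilon> * (t * ((\<integral>x. \<bar>f i x - g i x\<bar> \<partial>\<xi> i) - 2 * t))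
      \<le> J f + J g - 2 * J (\<lambda>i x. (f i x + g i x) / 2)"
proof -
  define gap where
    "gap i = cost i (f i) + cost i (g i) - 2 * cost i (\<lambda>x. (f i x + g i x) / 2)" for i
  have "lam i * (\<epsilon> * (t * ((\<integral>x. \<bar>f i x - g i x\<bar> \<partial>\<xi> i) - 2 * t))) \<le> lam i * gap i"
    unfolding gap_def using cost_gap(1)[OF i dens[OF f i] dens[OF g i] t] lam_pos[OF i]
    by (intro mult_left_mono) auto
  also have "\<dots> \<le> (\<Sum>i\<in>I. lam i * gap i)"
    using cost_gap(2) dens f g lam_pos
    by (intro member_le_sum i finite_I mult_nonneg_nonneg) (auto simp: gap_def less_imp_le)
  also have "\<dots> = J f + J g - 2 * J (\<lambda>i x. (f i x + g i x) / 2)"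
    unfolding J_def gap_def
    by (simp add: sum.distrib sum_subtractf sum_distrib_left distrib_left right_diff_distrib mult.left_commute)
  finally show ?thesis by (simp add: mult.assoc)
qed

section \<open>Lower semicontinuity\<close>

text \<open>The shift makes the integrand nonnegative, so that Fatou's lemma applies to it; since
  all densities have mass 1, it changes \<open>J\<close> only by a constant.\<close>

definition shifted_integrand :: "'i \<Rightarrow> 'a \<Rightarrow> real \<Rightarrow> real" where
  "shifted_integrand i x u = lam i * ((c i x + B) * u + \<epsilon> * (ent u + 1))"

lemma shifted_integrand_nonneg:
  assumes "i \<in> I" "x \<in> space (\<xi> i)" "0 \<le> u"
  shows "0 \<le> shifted_integrand i x u"
  using c_bound[OF assms(1,2)] lam_pos[OF assms(1)] ent_ge_minus_one[OF assms(3)] assms(3) \<epsilon>_pos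
  by (auto simp: shifted_integrand_def abs_le_iff intro!: mult_nonneg_nonneg add_nonneg_nonneg)

text \<open>The added \<open>B * u\<close> integrates to \<open>B\<close> because the density has
  mass 1, and the added \<epsilon> integrates to itself because \<open>\<xi> i\<close> has mass
  1.\<close>

lemma nn_integral_shifted:
  assumes i: "i \<in> I" and f: "entropic_density (\<xi> i) f"
  shows "(\<integral>\<^sup>+x. ennreal (shifted_integrand i x (f x)) \<partial>\<xi> i) = ennreal (lam i * (cost i f + (B + \<epsilon>)))"
    and "0 \<le> lam i * (cost i f + (B + \<epsilon>))"
proof -
  interpret prob_space "\<xi> i" by (rule prob[OF i])
  note fD = entropic_densityD[OF f]
  have expand: "shifted_integrand i x (f x)
      = lam i * (c i x * f x) + lam i * B * f x + lam i * \<epsilon> * ent (f x) + lam i * \<epsilon>" for x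
    by (simp add: shifted_integrand_def algebra_simps)
  have int: "integrable (\<xi> i) (\<lambda>x. shifted_integrand i x (f x))"
    unfolding expand using fD integrable_cost[OF i fD(2)] by simp
  have "(\<integral>x. shifted_integrand i x (f x) \<partial>\<xi> i)
      = lam i * (\<integral>x. c i x * f x \<partial>\<xi> i) + lam i * B + lam i * \<epsilon> * (\<integral>x. ent (f x) \<partial>\<xi> i) + lam i * \<epsilon>"
    unfolding expand using fD integrable_cost[OF i fD(2)] by (simp add: prob_space)
  then have eq: "(\<integral>x. shifted_integrand i x (f x) \<partial>\<xi> i) = lam i * (cost i f + (B + \<epsilon>))"
    by (simp add: cost_def algebra_simps)
  show "(\<integral>\<^sup>+x. ennreal (shifted_integrand i x (f x)) \<partial>\<xi> i) = ennreal (lam i * (cost i f + (B + \<epsilon>)))"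
    using nn_integral_eq_integral[OF int] shifted_integrand_nonneg[OF i _ fD(1)] eq by auto
  show "0 \<le> lam i * (cost i f + (B + \<epsilon>))"
    unfolding eq[symmetric] using shifted_integrand_nonneg[OF i _ fD(1)]
    by (intro integral_nonneg_AE AE_I2) auto
qed

lemma J_shifted:
  assumes "\<And>i. i \<in> I \<Longrightarrow> entropic_density (\<xi> i) (f i)"
  shows "(\<Sum>i\<in>I. \<integral>\<^sup>+x. ennreal (shifted_integrand i x (f i x)) \<partial>\<xi> i)
      = ennreal (J f + (\<Sum>i\<in>I. lam i * (B + \<epsilon>)))"
    and "0 \<le> J f + (\<Sum>i\<in>I. lam i * (B + \<epsilon>))"
proof -
  have eq: "J f + (\<Sum>i\<in>I. lam i * (B + \<epsilon>)) = (\<Sum>i\<in>I. lam i * (cost i (f i) + (B + \<epsilon>)))"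
    by (simp add: J_def sum.distrib[symmetric] distrib_left)
  show "(\<Sum>i\<in>I. \<integral>\<^sup>+x. ennreal (shifted_integrand i x (f i x)) \<partial>\<xi> i)
      = ennreal (J f + (\<Sum>i\<in>I. lam i * (B + \<epsilon>)))"
    unfolding eq using assms nn_integral_shifted by (simp add: sum_ennreal)
  show "0 \<le> J f + (\<Sum>i\<in>I. lam i * (B + \<epsilon>))"
    unfolding eq using assms nn_integral_shifted(2) by (intro sum_nonneg) auto
qed

text \<open>The limit is not assumed to have finite entropy. The Fatou bound on the nonnegative
  shifted integrals delivers this together with the inequality for \<open>J\<close>.\<close>

lemma J_lower_semicontinuous:
  assumes F: "\<And>n. F n \<in> K" and m: "(\<lambda>n. J (F n)) \<longlonglongrightarrow> m"
    and f: "\<And>i x. i \<in> I \<Longrightarrow> 0 \<le> f i x" "\<And>i. i \<in> I \<Longrightarrow> integrable (\<xi> i) (f i)"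
      "\<And>i. i \<in> I \<Longrightarrow> (\<integral>x. f i x \<partial>\<xi> i) = 1"
    and lim: "\<And>i. i \<in> I \<Longrightarrow> AE x in \<xi> i. (\<lambda>n. F n i x) \<longlonglongrightarrow> f i x"
  shows "i \<in> I \<Longrightarrow> entropic_density (\<xi> i) (f i)" and "J f \<le> m"
proof -
  define C where "C = (\<Sum>i\<in>I. lam i * (B + \<epsilon>))"
  \<comment> \<open>Needed to return to the reals at the end, since \<open>ennreal\<close> truncates
    negative numbers to 0.\<close>
  have "0 \<le> m + C"
    using tendsto_add[OF m tendsto_const[of C]] J_shifted(2)[OF dens[OF F]]
    by (intro LIMSEQ_le_const) (auto simp: C_def)
  have meas: "(\<lambda>x. ennreal (shifted_integrand i x (h x))) \<in> borel_measurable (\<xi> i)"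
    if "i \<in> I" "h \<in> borel_measurable (\<xi> i)" for i h
    using c_meas[OF that(1)] that(2) unfolding shifted_integrand_def by measurable
  have F_meas: "F n i \<in> borel_measurable (\<xi> i)" if "i \<in> I" for i n
    by (rule entropic_densityD(5)[OF dens[OF F that]])
  have "(\<Sum>i\<in>I. \<integral>\<^sup>+x. ennreal (shifted_integrand i x (f i x)) \<partial>\<xi> i)
      = (\<Sum>i\<in>I. \<integral>\<^sup>+x. liminf (\<lambda>n. ennreal (shifted_integrand i x (F n i x))) \<partial>\<xi> i)"
  proof (intro sum.cong refl nn_integral_cong_AE)
    fix i assume i: "i \<in> I"
    show "AE x in \<xi> i. ennreal (shifted_integrand i x (f i x))
        = liminf (\<lambda>n. ennreal (shifted_integrand i x (F n i x)))"
      using lim[OF i]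
    proof eventually_elim
      fix x assume l: "(\<lambda>n. F n i x) \<longlonglongrightarrow> f i x"
      have "(\<lambda>n. ent (F n i x)) \<longlonglongrightarrow> ent (f i x)"
        using tendsto_ent[OF l] entropic_densityD(1)[OF dens[OF F i]] f(1)[OF i] by auto
      then have "(\<lambda>n. ennreal (shifted_integrand i x (F n i x)))
          \<longlonglongrightarrow> ennreal (shifted_integrand i x (f i x))"
        unfolding shifted_integrand_def by (intro tendsto_intros l tendsto_ennrealI)
      then show "ennreal (shifted_integrand i x (f i x))
          = liminf (\<lambda>n. ennreal (shifted_integrand i x (F n i x)))"
        by (simp add: lim_imp_Liminf)
    qed
  qed
  also have "\<dots> \<le> (\<Sum>i\<in>I. liminf (\<lambda>n. \<integral>\<^sup>+x. ennreal (shifted_integrand i x (F n i x)) \<partial>\<xi> i))"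
    by (intro sum_mono nn_integral_liminf meas F_meas)
  \<comment> \<open>Fatou for counting measure: the limes inferior is superadditive\<close>
  also have "\<dots> = (\<integral>\<^sup>+i. liminf (\<lambda>n. \<integral>\<^sup>+x. ennreal (shifted_integrand i x (F n i x)) \<partial>\<xi> i)
      \<partial>count_space I)"
    using finite_I by (simp add: nn_integral_count_space_finite)
  also have "\<dots> \<le> liminf (\<lambda>n. \<integral>\<^sup>+i. (\<integral>\<^sup>+x. ennreal (shifted_integrand i x (F n i x)) \<partial>\<xi> i)
      \<partial>count_space I)"
    by (intro nn_integral_liminf) simp
  also have "\<dots> = liminf (\<lambda>n. ennreal (J (F n) + C))"
    using finite_I J_shifted(1)[OF dens[OF F]]
    by (simp add: nn_integral_count_space_finite C_def)
  also have "\<dots> = ennreal (m + C)"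
    by (intro lim_imp_Liminf tendsto_ennrealI tendsto_add m tendsto_const) simp
  finally have le: "(\<Sum>i\<in>I. \<integral>\<^sup>+x. ennreal (shifted_integrand i x (f i x)) \<partial>\<xi> i) \<le> ennreal (m + C)" .
  show dens_f: "entropic_density (\<xi> i) (f i)" if i: "i \<in> I" for i
  proof -
    interpret prob_space "\<xi> i" by (rule prob[OF i])
    note [measurable] = c_meas[OF i]
    have [measurable]: "f i \<in> borel_measurable (\<xi> i)" using f(2)[OF i] by auto
    have "(\<integral>\<^sup>+x. ennreal (shifted_integrand i x (f i x)) \<partial>\<xi> i) \<le> ennreal (m + C)"
      using le by (rule order_trans[rotated]) (intro member_le_sum i finite_I, auto)
    then have "(\<integral>\<^sup>+x. ennreal (norm (shifted_integrand i x (f i x))) \<partial>\<xi> i) < \<infinity>"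
      using shifted_integrand_nonneg[OF i _ f(1)[OF i]]
      by (subst nn_integral_cong[of _ _ "\<lambda>x. ennreal (shifted_integrand i x (f i x))"])
        (auto simp: le_less_trans)
    then have int: "integrable (\<xi> i) (\<lambda>x. shifted_integrand i x (f i x))"
      by (intro integrableI_bounded) (auto simp: shifted_integrand_def)
    \<comment> \<open>The shift is solved for the entropy term; the subtracted terms are integrable
      because the cost is bounded and the density is integrable.\<close>
    have "integrable (\<xi> i) (\<lambda>x. (shifted_integrand i x (f i x) / lam i - c i x * f i x - B * f i x) / \<epsilon> - 1)"
      using int integrable_cost[OF i f(2)[OF i]] f(2)[OF i] by auto
    moreover have "(shifted_integrand i x (f i x) / lam i - c i x * f i x - B * f i x) / \<epsilon> - 1 = ent (f i x)" for x
      using lam_pos[OF i] \<epsilon>_pos by (simp add: shifted_integrand_def field_simps)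
    ultimately show ?thesis using f[OF i] by (simp add: entropic_density_def)
  qed
  have "ennreal (J f + C) \<le> ennreal (m + C)"
    using le J_shifted(1)[OF dens_f] by (simp add: C_def)
  then show "J f \<le> m" using \<open>0 \<le> m + C\<close> by (simp add: ennreal_le_iff)
qed

section \<open>Existence and uniqueness of minimizing densities\<close>

theorem minimizer_exists:
  assumes "K \<noteq> {}"
  obtains f where "f \<in> K" "\<And>g. g \<in> K \<Longrightarrow> J f \<le> J g"
proof -
  have bdd: "bdd_below (J ` K)"
    using J_shifted(2)[OF dens] by (intro bdd_belowI2[of _ "- (\<Sum>i\<in>I. lam i * (B + \<epsilon>))"]) force
  define m where "m = Inf (J ` K)"
  have m_le: "m \<le> J g" if "g \<in> K" for g
    unfolding m_def using that bdd by (intro cInf_lower) auto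
  have "\<exists>g\<in>K. J g < m + (1/4)^n" for n :: nat
    using cInf_lessD[of "J ` K" "m + (1/4)^n"] assms by (auto simp: m_def)
  then obtain F where F: "\<And>n. F n \<in> K" "\<And>n. J (F n) < m + (1/4)^n" by metis
  have J_lim: "(\<lambda>n. J (F n)) \<longlonglongrightarrow> m"
  proof (rule tendsto_sandwich[OF _ _ tendsto_const])
    show "(\<lambda>n. m + (1/4)^n) \<longlonglongrightarrow> m"
      using tendsto_add[OF tendsto_const LIMSEQ_realpow_zero[of "1/4"]] by simp
  qed (auto intro!: always_eventually m_le F(1) less_imp_le[OF F(2)])
  have "\<exists>f. (\<forall>x. 0 \<le> f x) \<and> integrable (\<xi> i) f \<and> (AE x in \<xi> i. (\<lambda>n. F n i x) \<longlonglongrightarrow> f x) \<and>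
      (\<lambda>n. \<integral>x. \<bar>F n i x - f x\<bar> \<partial>\<xi> i) \<longlonglongrightarrow> 0" if i: "i \<in> I" for i
  proof -
    note FD = entropic_densityD[OF dens[OF F(1) i]]
    define a where "a = lam i * \<epsilon>"
    have a: "0 < a" using lam_pos[OF i] \<epsilon>_pos by (simp add: a_def)
    have bound: "(\<integral>x. \<bar>F n i x - F (Suc n) i x\<bar> \<partial>\<xi> i) \<le> (2 + 2 / a) * (1/2)^n" for n
    proof -
      \<comment> \<open>The square root of the accuracy \<open>(1/4)^n\<close>: both sides of the
        defect bound then carry a factor \<open>t\<close>, and cancelling it leaves a bound of order
        \<open>t\<close>.\<close>
      define t :: real where "t = (1/2)^n"
      have t: "0 < t" by (simp add: t_def)
      have tt: "(1/4)^n = t * t" by (simp add: t_def power_mult_distrib[symmetric])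
      have "a * (t * ((\<integral>x. \<bar>F n i x - F (Suc n) i x\<bar> \<partial>\<xi> i) - 2 * t))
          \<le> J (F n) + J (F (Suc n)) - 2 * J (\<lambda>i x. (F n i x + F (Suc n) i x) / 2)"
        unfolding a_def by (rule J_gap[OF F(1) F(1) i t])
      \<comment> \<open>The midpoint is a competitor, hence has value at least \<open>m\<close>; the
        two given values exceed \<open>m\<close> by less than \<open>(1/4)^n\<close> each.\<close>
      also have "\<dots> \<le> 2 * (t * t)"
        using F(2)[of n] F(2)[of "Suc n"] m_le[OF midpoint[OF F(1) F(1)], of n "Suc n"]
          mult_pos_pos[OF t t] by (simp add: tt; linarith)
      finally have "t * (a * ((\<integral>x. \<bar>F n i x - F (Suc n) i x\<bar> \<partial>\<xi> i) - 2 * t)) \<le> t * (2 * t)"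
        by (simp add: mult_ac)
      then have "a * ((\<integral>x. \<bar>F n i x - F (Suc n) i x\<bar> \<partial>\<xi> i) - 2 * t) \<le> 2 * t"
        using t by simp
      then have "(\<integral>x. \<bar>F n i x - F (Suc n) i x\<bar> \<partial>\<xi> i) \<le> (2 + 2 / a) * t"
        using a by (simp add: field_simps)
      then show ?thesis by (simp add: t_def)
    qed
    have "summable (\<lambda>n. (2 + 2 / a) * (1/2)^n)" by (intro summable_mult summable_geometric) simp
    then have "summable (\<lambda>n. \<integral>x. \<bar>F n i x - F (Suc n) i x\<bar> \<partial>\<xi> i)"
      by (rule summable_comparison_test') (use bound in auto)
    from L1_fast_Cauchy_limit[of "\<xi> i" "\<lambda>n. F n i", OF FD(2,1) this] show ?thesis .
  qed
  then have "\<forall>i\<in>I. \<exists>f. (\<forall>x. 0 \<le> f x) \<and> integrable (\<xi> i) f \<and>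
      (AE x in \<xi> i. (\<lambda>n. F n i x) \<longlonglongrightarrow> f x) \<and> (\<lambda>n. \<integral>x. \<bar>F n i x - f x\<bar> \<partial>\<xi> i) \<longlonglongrightarrow> 0"
    by blast
  from bchoice[OF this] obtain f where
    "\<forall>i\<in>I. (\<forall>x. 0 \<le> f i x) \<and> integrable (\<xi> i) (f i) \<and>
      (AE x in \<xi> i. (\<lambda>n. F n i x) \<longlonglongrightarrow> f i x) \<and> (\<lambda>n. \<integral>x. \<bar>F n i x - f i x\<bar> \<partial>\<xi> i) \<longlonglongrightarrow> 0" ..
  then have f: "\<And>i x. i \<in> I \<Longrightarrow> 0 \<le> f i x" "\<And>i. i \<in> I \<Longrightarrow> integrable (\<xi> i) (f i)"
      "\<And>i. i \<in> I \<Longrightarrow> AE x in \<xi> i. (\<lambda>n. F n i x) \<longlonglongrightarrow> f i x"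
      "\<And>i. i \<in> I \<Longrightarrow> (\<lambda>n. \<integral>x. \<bar>F n i x - f i x\<bar> \<partial>\<xi> i) \<longlonglongrightarrow> 0"
    by simp_all
  have mass: "(\<integral>x. f i x \<partial>\<xi> i) = 1" if i: "i \<in> I" for i
  proof -
    note FD = entropic_densityD[OF dens[OF F(1) i]]
    have "\<bar>1 - (\<integral>x. f i x \<partial>\<xi> i)\<bar> \<le> (\<integral>x. \<bar>F n i x - f i x\<bar> \<partial>\<xi> i)" for n
      using integral_abs_bound[of "\<xi> i" "\<lambda>x. F n i x - f i x"] FD(2,3)[of n] f(2)[OF i] by simp
    then have "\<bar>1 - (\<integral>x. f i x \<partial>\<xi> i)\<bar> \<le> 0"
      using f(4)[OF i] by (intro LIMSEQ_le_const) auto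
    then show ?thesis by simp
  qed
  \<comment> \<open>The limit has mass 1 by \<open>L^1\<close> convergence. Semicontinuity then
    makes its entropy finite, which \<open>L1_closed\<close> requires before it grants membership in
    \<open>K\<close>.\<close>
  note lsc = J_lower_semicontinuous[OF F(1) J_lim f(1,2) mass f(3)]
  have "f \<in> K" by (rule L1_closed[OF F(1) lsc(1) f(4)])
  then show ?thesis using that lsc(2) m_le by force
qed

theorem minimizer_unique:
  assumes f: "f \<in> K" "\<And>h. h \<in> K \<Longrightarrow> J f \<le> J h" and g: "g \<in> K" "\<And>h. h \<in> K \<Longrightarrow> J g \<le> J h"
    and i: "i \<in> I"
  shows "AE x in \<xi> i. f i x = g i x"
proof -
  note fD = entropic_densityD[OF dens[OF f(1) i]] and gD = entropic_densityD[OF dens[OF g(1) i]]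
  have a: "0 < lam i * \<epsilon>" using lam_pos[OF i] \<epsilon>_pos by simp
  \<comment> \<open>Neither minimizer exceeds the midpoint in value, so the defect is at most 0.
    Taking \<open>t = e/2\<close> in \<open>J_gap\<close> then bounds the distance by
    \<open>2 * t = e\<close>.\<close>
  have "(\<integral>x. \<bar>f i x - g i x\<bar> \<partial>\<xi> i) \<le> 0 + e" if "0 < e" for e
  proof -
    have "(lam i * \<epsilon> * (e/2)) * ((\<integral>x. \<bar>f i x - g i x\<bar> \<partial>\<xi> i) - 2 * (e/2)) \<le> 0"
      unfolding mult.assoc[of "lam i * \<epsilon>"] using J_gap[OF f(1) g(1) i, of "e/2"] f(2)[OF midpoint[OF f(1) g(1)]]
        g(2)[OF midpoint[OF f(1) g(1)]] that by simp
    then have "(\<integral>x. \<bar>f i x - g i x\<bar> \<partial>\<xi> i) - 2 * (e/2) \<le> 0"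
      by (rule contrapos_pp) (use a that in \<open>simp add: not_le del: mult_less_cancel_right_disj\<close>)
    then show ?thesis by simp
  qed
  then have "(\<integral>x. \<bar>f i x - g i x\<bar> \<partial>\<xi> i) \<le> 0" by (rule field_le_epsilon)
  then have "(\<integral>x. \<bar>f i x - g i x\<bar> \<partial>\<xi> i) = 0"
    by (intro antisym Bochner_Integration.integral_nonneg) auto
  then have "AE x in \<xi> i. \<bar>f i x - g i x\<bar> = 0"
    using fD(2) gD(2) by (subst (asm) integral_nonneg_eq_0_iff_AE) auto
  then show ?thesis by simp
qed

end

section \<open>Relative entropy and densities\<close>

text \<open>The density agrees almost everywhere with the Radon-Nikodym derivative, and integrating
  its logarithm against \<open>density M f\<close> produces \<open>ent\<close>. The negative part
  has integral at most 1, so the value is finite exactly when the entropy is integrable and is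
  otherwise \<open>\<infinity>\<close>.\<close>

lemma KL_density:
  assumes M: "prob_space M" and [measurable]: "f \<in> borel_measurable M"
    and nonneg: "\<And>x. 0 \<le> f x"
  shows "KL (density M (\<lambda>x. ennreal (f x))) M
    = (if integrable M (\<lambda>x. ent (f x)) then ereal (\<integral>x. ent (f x) \<partial>M) else \<infinity>)"
proof -
  interpret prob_space M by fact
  define N where "N = density M (\<lambda>x. ennreal (f x))"
  have ac: "absolutely_continuous M N"
    unfolding N_def by (intro absolutely_continuousI_density) measurable
  have "AE x in M. ennreal (f x) = RN_deriv M N x"
    by (rule RN_deriv_unique) (auto simp: N_def)
  then have RN: "AE x in M. enn2real (RN_deriv M N x) = f x"
    by eventually_elim (metis enn2real_ennreal nonneg)
  \<comment> \<open>The sign \<open>s\<close> treats the positive part (\<open>s = 1\<close>) and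
    the negative part (\<open>s = -1\<close>) in one computation.\<close>
  have conv: "(\<integral>\<^sup>+x. ennreal (s * ln (enn2real (RN_deriv M N x))) \<partial>N) = (\<integral>\<^sup>+x. ennreal (s * ent (f x)) \<partial>M)"
    for s :: real
    unfolding N_def
  proof (subst nn_integral_density)
    show "(\<integral>\<^sup>+x. ennreal (f x) * ennreal (s * ln (enn2real (RN_deriv M (density M (\<lambda>x. ennreal (f x))) x))) \<partial>M)
        = (\<integral>\<^sup>+x. ennreal (s * ent (f x)) \<partial>M)"
    proof (rule nn_integral_cong_AE)
      show "AE x in M. ennreal (f x) * ennreal (s * ln (enn2real (RN_deriv M (density M (\<lambda>x. ennreal (f x))) x)))
          = ennreal (s * ent (f x))"
        using RN unfolding N_def
      proof eventually_elim
        case (elim x)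
        show ?case unfolding elim using nonneg[of x]
          by (simp add: ent_def ennreal_mult'[symmetric] mult_ac)
      qed
    qed
  qed measurable
  have "(\<integral>\<^sup>+x. ennreal (- ent (f x)) \<partial>M) \<le> (\<integral>\<^sup>+x. 1 \<partial>M)"
  proof (intro nn_integral_mono)
    fix x show "ennreal (- ent (f x)) \<le> 1"
      using ent_ge_minus_one[OF nonneg[of x]] by (simp add: ennreal_le_1)
  qed
  then have neg: "(\<integral>\<^sup>+x. ennreal (- ent (f x)) \<partial>M) \<le> 1" by (simp add: emeasure_space_1)
  have KL: "KL N M = enn2ereal (\<integral>\<^sup>+x. ennreal (ent (f x)) \<partial>M) - enn2ereal (\<integral>\<^sup>+x. ennreal (- ent (f x)) \<partial>M)"
    using ac conv[of 1] conv[of "-1"] by (simp add: KL_def ereal_integral_def)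
  show ?thesis
  proof (cases "integrable M (\<lambda>x. ent (f x))")
    case True
    have fin: "(\<integral>\<^sup>+x. ennreal (ent (f x)) \<partial>M) \<noteq> \<infinity>"
      using True by (simp add: real_integrable_def)
    have "(\<integral>x. ent (f x) \<partial>M) = enn2real (\<integral>\<^sup>+x. ennreal (ent (f x)) \<partial>M) - enn2real (\<integral>\<^sup>+x. ennreal (- ent (f x)) \<partial>M)"
      by (rule real_lebesgue_integral_def[OF True])
    then show ?thesis
      using True KL fin neg unfolding N_def
      by (cases "\<integral>\<^sup>+x. ennreal (ent (f x)) \<partial>M"; cases "\<integral>\<^sup>+x. ennreal (- ent (f x)) \<partial>M")
        (auto simp: enn2ereal_ennreal top_unique)
  next
    case False
    then have "(\<integral>\<^sup>+x. ennreal (ent (f x)) \<partial>M) = \<infinity>"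
      using neg by (auto simp: real_integrable_def top_unique)
    then show ?thesis
      using False KL neg unfolding N_def
      by (cases "\<integral>\<^sup>+x. ennreal (- ent (f x)) \<partial>M") (auto simp: enn2ereal_ennreal top_unique)
  qed
qed

text \<open>The Radon-Nikodym derivative can be infinite only on a null set, where
  \<open>enn2real\<close> replaces it by 0. This yields a version that is real and nonnegative at
  every point.\<close>

lemma ex_real_density:
  assumes M: "prob_space M" and N: "prob_space N" and ac: "absolutely_continuous M N"
    and sets: "sets N = sets M"
  obtains f where "f \<in> borel_measurable M" "\<forall>x. 0 \<le> f x" "N = density M (\<lambda>x. ennreal (f x))"
    "integrable M f" "(\<integral>x. f x \<partial>M) = 1"
proof -
  interpret M: prob_space M by fact
  interpret N: prob_space N by fact
  define f where "f x = enn2real (RN_deriv M N x)" for x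
  have f_meas [measurable]: "f \<in> borel_measurable M" unfolding f_def by measurable
  have f_nonneg: "0 \<le> f x" for x by (simp add: f_def)
  have "AE x in M. RN_deriv M N x \<noteq> \<infinity>"
    by (rule M.RN_deriv_finite[OF N.sigma_finite_measure_axioms ac sets])
  then have eq: "AE x in M. RN_deriv M N x = ennreal (f x)"
    by eventually_elim (auto simp: f_def less_top)
  have "N = density M (RN_deriv M N)" using M.density_RN_deriv[OF ac sets] by simp
  also have "\<dots> = density M (\<lambda>x. ennreal (f x))" using eq by (intro density_cong) auto
  finally have N_eq: "N = density M (\<lambda>x. ennreal (f x))" .
  have "1 = emeasure N (space M)"
    using N.emeasure_space_1 sets_eq_imp_space_eq[OF sets] by simp
  also have "\<dots> = (\<integral>\<^sup>+x. ennreal (f x) * indicator (space M) x \<partial>M)"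
    by (simp add: N_eq emeasure_density)
  also have "\<dots> = (\<integral>\<^sup>+x. ennreal (f x) \<partial>M)" by (intro nn_integral_cong) auto
  finally have one: "(\<integral>\<^sup>+x. ennreal (f x) \<partial>M) = 1" by simp
  then have int: "integrable M f" using f_nonneg by (intro integrableI_nonneg) auto
  moreover have "(\<integral>x. f x \<partial>M) = 1"
    using one f_nonneg by (simp add: integral_eq_nn_integral)
  ultimately show ?thesis using that f_meas f_nonneg N_eq by blast
qed

section \<open>Borel sets of products\<close>

text \<open>Compactness gives a finite net at each scale \<open>1 / Suc n\<close>; the balls of
  these radii around the net points form a countable base.\<close>

lemma second_countable_compact_metric:
  assumes "compact_space (mtopology_of m)"
  shows "second_countable (mtopology_of m)"
proof -
  interpret Metric_space "mspace m" "mdist m" by simp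
  have top: "mtopology_of m = mtopology" by (simp add: mtopology_of_def)
  have "mtotally_bounded (mspace m)"
    using assms unfolding top compact_space_eq_mcomplete_mtotally_bounded by simp
  then have "\<exists>C. finite C \<and> C \<subseteq> mspace m \<and> mspace m \<subseteq> (\<Union>x\<in>C. mball x (1 / real (Suc n)))" for n
    by (simp add: mtotally_bounded_def)
  then obtain C where C: "\<And>n. finite (C n)" "\<And>n. C n \<subseteq> mspace m"
      "\<And>n. mspace m \<subseteq> (\<Union>x\<in>C n. mball x (1 / real (Suc n)))"
    by metis
  define \<B> where "\<B> = (\<Union>n. (\<lambda>x. mball x (1 / real (Suc n))) ` C n)"
  have "\<exists>V\<in>\<B>. x \<in> V \<and> V \<subseteq> U" if U: "openin mtopology U" and x: "x \<in> U" for U x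
  proof -
    obtain r where r: "0 < r" "mball x r \<subseteq> U" using U x by (auto simp: openin_mtopology)
    have xm: "x \<in> mspace m" using U x by (auto simp: openin_mtopology)
    \<comment> \<open>Half of \<open>r\<close>, because the distance from \<open>x\<close> to a
      point of the small ball is estimated through its centre \<open>y\<close>.\<close>
    obtain n where n: "1 / real (Suc n) < r / 2"
      using reals_Archimedean[of "r / 2"] r by (auto simp: inverse_eq_divide)
    obtain y where y: "y \<in> C n" "x \<in> mball y (1 / real (Suc n))" using C(3)[of n] xm by blast
    have "mball y (1 / real (Suc n)) \<subseteq> mball x r"
    proof
      fix z assume z: "z \<in> mball y (1 / real (Suc n))"
      have "mdist m x z \<le> mdist m x y + mdist m y z" using y z by (intro triangle) auto
      also have "\<dots> < r" using y z n by (auto simp: commute)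
      finally show "z \<in> mball x r" using z xm by auto
    qed
    then show ?thesis using y r unfolding \<B>_def by blast
  qed
  moreover have "countable \<B>" unfolding \<B>_def
    using C(1) by (intro countable_UN countable_image) (auto intro: countable_finite)
  ultimately show ?thesis unfolding second_countable_def top
    by (intro exI[of _ \<B>]) (auto simp: \<B>_def)
qed

lemma space_borel_of [simp]: "space (borel_of T) = topspace T"
  unfolding borel_of_def by (rule space_measure_of) (auto dest: openin_subset)

lemma sets_borel_of: "sets (borel_of T) = sigma_sets (topspace T) {U. openin T U}"
  unfolding borel_of_def by (rule sets_measure_of) (auto dest: openin_subset)

lemma openin_sets_borel_of: "openin T U \<Longrightarrow> U \<in> sets (borel_of T)"
  by (auto simp: sets_borel_of)

lemma continuous_map_measurable:
  assumes "continuous_map S T f"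
  shows "f \<in> measurable (borel_of S) (borel_of T)"
  unfolding borel_of_def[of T]
proof (rule measurable_sigma_sets)
  show "sets (sigma (topspace T) {U. openin T U}) = sigma_sets (topspace T) {U. openin T U}"
    using sets_borel_of[of T] by (simp add: borel_of_def)
  show "f \<in> space (borel_of S) \<rightarrow> topspace T" using assms by (auto simp: continuous_map_def)
  fix U assume "U \<in> {U. openin T U}"
  then have "openin S {x \<in> topspace S. f x \<in> U}"
    using assms by (auto simp: continuous_map_def)
  moreover have "f -` U \<inter> space (borel_of S) = {x \<in> topspace S. f x \<in> U}" by auto
  ultimately show "f -` U \<inter> space (borel_of S) \<in> sets (borel_of S)"
    by (simp add: openin_sets_borel_of)
qed (auto dest: openin_subset)

lemma borel_of_euclidean: "sets (borel_of (euclidean :: 'a::topological_space topology)) = sets borel"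
  by (simp add: sets_borel_of borel_def)

lemma continuous_map_real_borel_measurable:
  assumes "continuous_map S euclideanreal f"
  shows "f \<in> borel_measurable (borel_of S)"
  using continuous_map_measurable[OF assms]
  unfolding measurable_cong_sets[OF refl borel_of_euclidean] .

text \<open>Countable bases are what make an open set of the product a countable union of open
  rectangles, hence product measurable. The converse inclusion only uses that the projections are
  continuous.\<close>

lemma sets_borel_of_prod:
  assumes "second_countable S" "second_countable T"
  shows "sets (borel_of (prod_topology S T)) = sets (borel_of S \<Otimes>\<^sub>M borel_of T)"
proof
  obtain \<A> where \<A>: "countable \<A>" "\<forall>V\<in>\<A>. openin S V"
    "\<forall>U x. openin S U \<and> x \<in> U \<longrightarrow> (\<exists>V\<in>\<A>. x \<in> V \<and> V \<subseteq> U)"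
    using assms(1) unfolding second_countable_def by blast
  obtain \<B> where \<B>: "countable \<B>" "\<forall>V\<in>\<B>. openin T V"
    "\<forall>U x. openin T U \<and> x \<in> U \<longrightarrow> (\<exists>V\<in>\<B>. x \<in> V \<and> V \<subseteq> U)"
    using assms(2) unfolding second_countable_def by blast
  have "W \<in> sets (borel_of S \<Otimes>\<^sub>M borel_of T)" if W: "openin (prod_topology S T) W" for W
  proof -
    define R where "R = {(U, V). (U, V) \<in> \<A> \<times> \<B> \<and> U \<times> V \<subseteq> W}"
    have "countable R" using \<A>(1) \<B>(1)
      by (intro countable_subset[of R "\<A> \<times> \<B>"]) (auto simp: R_def)
    have "W = (\<Union>(U, V)\<in>R. U \<times> V)"
    proof (intro equalityI subsetI)
      fix z assume z: "z \<in> W"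
      obtain U V where UV: "openin S U" "openin T V" "fst z \<in> U" "snd z \<in> V" "U \<times> V \<subseteq> W"
        using W z unfolding openin_prod_topology_alt by (metis prod.collapse)
      obtain U' V' where "U' \<in> \<A>" "fst z \<in> U'" "U' \<subseteq> U" "V' \<in> \<B>" "snd z \<in> V'" "V' \<subseteq> V"
        using \<A>(3)[rule_format, OF conjI[OF UV(1,3)]] \<B>(3)[rule_format, OF conjI[OF UV(2,4)]]
        by blast
      moreover have "U' \<times> V' \<subseteq> W" using calculation UV(5) by blast
      ultimately show "z \<in> (\<Union>(U, V)\<in>R. U \<times> V)"
        by (intro UN_I[of "(U', V')"]) (auto simp: R_def mem_Times_iff)
    qed (auto simp: R_def)
    also have "\<dots> \<in> sets (borel_of S \<Otimes>\<^sub>M borel_of T)"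
      using \<open>countable R\<close>
      by (rule sets.countable_UN') (auto simp: R_def intro!: pair_measureI openin_sets_borel_of \<A>(2)[rule_format] \<B>(2)[rule_format])
    finally show ?thesis .
  qed
  then show "sets (borel_of (prod_topology S T)) \<subseteq> sets (borel_of S \<Otimes>\<^sub>M borel_of T)"
    unfolding sets_borel_of[of "prod_topology S T"]
    by (intro sets.sigma_sets_subset') (auto simp: space_pair_measure sets.top[of "borel_of S \<Otimes>\<^sub>M borel_of T", unfolded space_pair_measure, simplified])
  have "id \<in> measurable (borel_of (prod_topology S T)) (borel_of S \<Otimes>\<^sub>M borel_of T)"
    using continuous_map_measurable[OF continuous_map_fst, of S T]
      continuous_map_measurable[OF continuous_map_snd, of S T]
    by (intro measurable_pair) (auto simp: comp_def)
  then show "sets (borel_of S \<Otimes>\<^sub>M borel_of T) \<subseteq> sets (borel_of (prod_topology S T))"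
    using sets.sets_into_space[of _ "borel_of S \<Otimes>\<^sub>M borel_of T"]
    by (force dest: measurable_sets simp: space_pair_measure Int_absorb2)
qed

section \<open>Entropic barycenters\<close>

lemma emeasure_distr_density:
  assumes f: "integrable M f" "\<And>x. 0 \<le> f x" and h: "h \<in> measurable M S" and A: "A \<in> sets S"
  shows "emeasure (distr (density M (\<lambda>x. ennreal (f x))) S h) A
      = ennreal (\<integral>x. f x * indicator A (h x) \<partial>M)"
proof -
  note [measurable] = h A
  have [measurable]: "f \<in> borel_measurable M" using f by auto
  have int: "integrable M (\<lambda>x. f x * indicator A (h x))"
    by (rule Bochner_Integration.integrable_bound[OF f(1)]) (auto simp: indicator_def)
  have "emeasure (distr (density M (\<lambda>x. ennreal (f x))) S h) A
      = (\<integral>\<^sup>+x. ennreal (f x) * indicator (h -` A \<inter> space M) x \<partial>M)"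
    by (simp add: emeasure_distr emeasure_density)
  also have "\<dots> = (\<integral>\<^sup>+x. ennreal (f x * indicator A (h x)) \<partial>M)"
    by (intro nn_integral_cong) (auto simp: indicator_def)
  also have "\<dots> = ennreal (\<integral>x. f x * indicator A (h x) \<partial>M)"
    using int f(2) by (intro nn_integral_eq_integral) auto
  finally show ?thesis .
qed

text \<open>Turns a marginal constraint into real equations linear in \<open>f\<close>, the form in
  which it passes to midpoints and to \<open>L^1\<close> limits.\<close>

lemma distr_density_eq_iff:
  assumes f: "integrable M f" "\<And>x. 0 \<le> f x" and h: "h \<in> measurable M S"
    and N: "finite_measure N" "sets N = sets S"
  shows "distr (density M (\<lambda>x. ennreal (f x))) S h = N
    \<longleftrightarrow> (\<forall>A\<in>sets S. (\<integral>x. f x * indicator A (h x) \<partial>M) = measure N A)"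
proof -
  interpret N: finite_measure N by fact
  have "0 \<le> (\<integral>x. f x * indicator A (h x) \<partial>M)" for A
    using f(2) by (intro Bochner_Integration.integral_nonneg) auto
  then have "emeasure (distr (density M (\<lambda>x. ennreal (f x))) S h) A = emeasure N A
      \<longleftrightarrow> (\<integral>x. f x * indicator A (h x) \<partial>M) = measure N A" if "A \<in> sets S" for A
    using emeasure_distr_density[OF f h that] by (simp add: N.emeasure_eq_measure)
  then show ?thesis
    using N(2) by (auto intro!: measure_eqI)
qed

text \<open>Since indicators are bounded by 1, the difference of the integrals is at most the
  \<open>L^1\<close> distance.\<close>

lemma tendsto_integral_indicator_L1:
  fixes F :: "nat \<Rightarrow> 'a \<Rightarrow> real"
  assumes F: "\<And>n. integrable M (F n)" and f: "integrable M f"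
    and lim: "(\<lambda>n. \<integral>x. \<bar>F n x - f x\<bar> \<partial>M) \<longlonglongrightarrow> 0"
    and h: "h \<in> measurable M S" and A: "A \<in> sets S"
  shows "(\<lambda>n. \<integral>x. F n x * indicator A (h x) \<partial>M) \<longlonglongrightarrow> (\<integral>x. f x * indicator A (h x) \<partial>M)"
proof -
  note [measurable] = h A
  have int: "integrable M (\<lambda>x. g x * indicator A (h x))" if "integrable M g" for g :: "'a \<Rightarrow> real"
  proof -
    have [measurable]: "g \<in> borel_measurable M" using that by auto
    show ?thesis
      by (rule Bochner_Integration.integrable_bound[OF that]) (auto simp: indicator_def)
  qed
  have "\<bar>(\<integral>x. F n x * indicator A (h x) \<partial>M) - (\<integral>x. f x * indicator A (h x) \<partial>M)\<bar>
      \<le> (\<integral>x. \<bar>F n x - f x\<bar> \<partial>M)" for n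
  proof -
    have "(\<integral>x. F n x * indicator A (h x) \<partial>M) - (\<integral>x. f x * indicator A (h x) \<partial>M)
        = (\<integral>x. F n x * indicator A (h x) - f x * indicator A (h x) \<partial>M)"
      using int[OF F] int[OF f] by simp
    also have "\<bar>\<dots>\<bar> \<le> (\<integral>x. \<bar>F n x * indicator A (h x) - f x * indicator A (h x)\<bar> \<partial>M)"
      by (rule integral_abs_bound)
    also have "\<dots> \<le> (\<integral>x. \<bar>F n x - f x\<bar> \<partial>M)"
      using int[OF F] int[OF f] F f by (intro integral_mono) (auto simp: indicator_def)
    finally show ?thesis .
  qed
  then have "(\<lambda>n. (\<integral>x. F n x * indicator A (h x) \<partial>M) - (\<integral>x. f x * indicator A (h x) \<partial>M)) \<longlonglongrightarrow> 0"
    by (intro tendsto_rabs_zero_cancel[OF tendsto_sandwich[OF _ _ tendsto_const lim]])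
      (auto intro!: always_eventually)
  then show ?thesis by (rule LIM_zero_cancel)
qed

locale entropic_barycenter =
  fixes p :: nat
    and \<epsilon> :: real
    and X :: "nat \<Rightarrow> 'a metric"
    and Y :: "'b metric"
    and lam :: "nat \<Rightarrow> real"
    and c :: "nat \<Rightarrow> 'a \<times> 'b \<Rightarrow> real"
    and \<nu> :: "nat \<Rightarrow> 'a measure"
    and \<eta> :: "'b measure"
  assumes p_pos: "1 \<le> p" and \<epsilon>_pos: "0 < \<epsilon>"
    and X_compact: "\<And>i. i \<in> {1..p} \<Longrightarrow> compact_space (mtopology_of (X i))"
    and Y_compact: "compact_space (mtopology_of Y)"
    and \<nu>: "\<And>i. i \<in> {1..p} \<Longrightarrow> \<nu> i \<in> borel_probs (mtopology_of (X i))"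
    and c_cont: "\<And>i. i \<in> {1..p} \<Longrightarrow>
           continuous_map (prod_topology (mtopology_of (X i)) (mtopology_of Y)) euclideanreal (c i)"
    and lam_pos: "\<And>i. i \<in> {1..p} \<Longrightarrow> 0 < lam i"
    and \<eta>: "\<eta> \<in> borel_probs (mtopology_of Y)"
begin

section \<open>Feasible tuples as a class of densities\<close>

definition \<xi> :: "nat \<Rightarrow> ('a \<times> 'b) measure" where
  "\<xi> i = \<nu> i \<Otimes>\<^sub>M \<eta>"

text \<open>Restricted to \<open>{1..p}\<close> because \<open>feasible\<close> consists of
  extensional functions.\<close>

definition plans :: "(nat \<Rightarrow> 'a \<times> 'b \<Rightarrow> real) \<Rightarrow> nat \<Rightarrow> ('a \<times> 'b) measure" where
  "plans f = (\<lambda>i\<in>{1..p}. density (\<xi> i) (\<lambda>z. ennreal (f i z)))"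

text \<open>Members are unconstrained outside \<open>{1..p}\<close>, and densities are determined
  only up to null sets, so uniqueness can be expected of \<open>plans f\<close> but not of
  \<open>f\<close>.\<close>

definition K :: "(nat \<Rightarrow> 'a \<times> 'b \<Rightarrow> real) set" where
  "K = {f. (\<forall>i\<in>{1..p}. entropic_density (\<xi> i) (f i)) \<and> plans f \<in> feasible p X Y \<nu>}"

lemma prob_space_\<nu>: "i \<in> {1..p} \<Longrightarrow> prob_space (\<nu> i)"
  and sets_\<nu>: "i \<in> {1..p} \<Longrightarrow> sets (\<nu> i) = sets (borel_of (mtopology_of (X i)))"
  and prob_space_\<eta>: "prob_space \<eta>"
  and sets_\<eta>: "sets \<eta> = sets (borel_of (mtopology_of Y))"
  using \<nu> \<eta> by (auto simp: borel_probs_def)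

lemma prob_space_\<xi>: "i \<in> {1..p} \<Longrightarrow> prob_space (\<xi> i)"
  unfolding \<xi>_def by (intro prob_space_pair prob_space_\<nu> prob_space_\<eta>)

lemma sets_\<xi>:
  assumes "i \<in> {1..p}"
  shows "sets (\<xi> i) = sets (borel_of (prod_topology (mtopology_of (X i)) (mtopology_of Y)))"
  using sets_pair_measure_cong[OF sets_\<nu>[OF assms] sets_\<eta>]
    sets_borel_of_prod[OF second_countable_compact_metric[OF X_compact[OF assms]]
      second_countable_compact_metric[OF Y_compact]]
  by (simp add: \<xi>_def)

lemma measurable_fst_\<xi>:
  assumes "i \<in> {1..p}"
  shows "fst \<in> measurable (\<xi> i) (borel_of (mtopology_of (X i)))"
  unfolding \<xi>_def measurable_cong_sets[OF refl sets_\<nu>[OF assms, symmetric]] by (rule measurable_fst)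

lemma measurable_snd_\<xi>: "snd \<in> measurable (\<xi> i) (borel_of (mtopology_of Y))"
  unfolding \<xi>_def measurable_cong_sets[OF refl sets_\<eta>[symmetric]] by (rule measurable_snd)

lemma measurable_c: "i \<in> {1..p} \<Longrightarrow> c i \<in> borel_measurable (\<xi> i)"
  using continuous_map_real_borel_measurable[OF c_cont]
  by (subst measurable_cong_sets[OF sets_\<xi> refl])

lemma c_bounded: "\<exists>B. \<forall>i\<in>{1..p}. \<forall>x\<in>space (\<xi> i). \<bar>c i x\<bar> \<le> B"
proof -
  have "\<exists>b. \<forall>x\<in>space (\<xi> i). \<bar>c i x\<bar> \<le> b" if i: "i \<in> {1..p}" for i
  proof -
    let ?T = "prod_topology (mtopology_of (X i)) (mtopology_of Y)"
    have "compact_space ?T"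
      using X_compact[OF i] Y_compact by (simp add: compact_space_prod_topology)
    then have "compactin euclideanreal (c i ` topspace ?T)"
      using c_cont[OF i] by (intro image_compactin) (auto simp: compact_space_def)
    then have "bounded (c i ` topspace ?T)" by (simp add: compact_imp_bounded)
    moreover have "space (\<xi> i) = topspace ?T"
      using sets_eq_imp_space_eq[OF sets_\<xi>[OF i]] by simp
    ultimately show ?thesis by (auto simp: bounded_iff)
  qed
  then obtain b where b: "\<And>i x. i \<in> {1..p} \<Longrightarrow> x \<in> space (\<xi> i) \<Longrightarrow> \<bar>c i x\<bar> \<le> b i" by metis
  have "\<bar>c i x\<bar> \<le> (\<Sum>j=1..p. \<bar>b j\<bar>)" if i: "i \<in> {1..p}" and x: "x \<in> space (\<xi> i)" for i x
  proof -
    have "\<bar>c i x\<bar> \<le> \<bar>b i\<bar>" using b[OF i x] by simp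
    also have "\<dots> \<le> (\<Sum>j=1..p. \<bar>b j\<bar>)" by (rule member_le_sum[OF i]) auto
    finally show ?thesis .
  qed
  then show ?thesis by blast
qed

text \<open>The common marginal is existentially quantified in \<open>feasible\<close>. If it exists
  it must be the second marginal of index 1, so this serves as the witness and the quantifier
  becomes an equation between integrals.\<close>

lemma plans_feasible_iff:
  assumes f: "\<forall>i\<in>{1..p}. entropic_density (\<xi> i) (f i)"
  shows "plans f \<in> feasible p X Y \<nu> \<longleftrightarrow>
    (\<forall>i\<in>{1..p}. \<forall>A\<in>sets (borel_of (mtopology_of (X i))).
       (\<integral>z. f i z * indicator A (fst z) \<partial>\<xi> i) = measure (\<nu> i) A) \<and>
    (\<forall>i\<in>{1..p}. \<forall>A\<in>sets (borel_of (mtopology_of Y)).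
       (\<integral>z. f i z * indicator A (snd z) \<partial>\<xi> i) = (\<integral>z. f 1 z * indicator A (snd z) \<partial>\<xi> 1))"
    (is "?L \<longleftrightarrow> ?P \<and> ?Q")
proof -
  have one: "1 \<in> {1..p}" using p_pos by simp
  note fD = entropic_densityD[OF f[rule_format]]
  have prob: "prob_space (density (\<xi> i) (\<lambda>z. ennreal (f i z)))" if "i \<in> {1..p}" for i
  proof (rule prob_spaceI)
    have [measurable]: "f i \<in> borel_measurable (\<xi> i)" using fD(5)[OF that] .
    have "emeasure (density (\<xi> i) (\<lambda>z. ennreal (f i z))) (space (\<xi> i)) = (\<integral>\<^sup>+z. ennreal (f i z) \<partial>\<xi> i)"
      by (subst emeasure_density) (auto intro!: nn_integral_cong)
    also have "\<dots> = ennreal (\<integral>z. f i z \<partial>\<xi> i)"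
      using fD(1,2)[OF that] by (intro nn_integral_eq_integral) auto
    finally show "emeasure (density (\<xi> i) (\<lambda>z. ennreal (f i z)))
        (space (density (\<xi> i) (\<lambda>z. ennreal (f i z)))) = 1"
      using fD(3)[OF that] by simp
  qed
  define \<mu> where "\<mu> i = distr (density (\<xi> i) (\<lambda>z. ennreal (f i z))) (borel_of (mtopology_of Y)) snd" for i
  have \<mu>: "\<mu> i \<in> borel_probs (mtopology_of Y)" if "i \<in> {1..p}" for i
    using prob_space.prob_space_distr[OF prob[OF that]] measurable_snd_\<xi>
    by (auto simp: borel_probs_def \<mu>_def)
  have fst: "distr (density (\<xi> i) (\<lambda>z. ennreal (f i z))) (borel_of (mtopology_of (X i))) fst = \<nu> i \<longleftrightarrow>
      (\<forall>A\<in>sets (borel_of (mtopology_of (X i))). (\<integral>z. f i z * indicator A (fst z) \<partial>\<xi> i) = measure (\<nu> i) A)"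
    if i: "i \<in> {1..p}" for i
    using prob_space_\<nu>[OF i]
    by (intro distr_density_eq_iff fD(1,2)[OF i] measurable_fst_\<xi> sets_\<nu> i)
      (simp add: prob_space_def)
  have snd: "\<mu> i = \<mu> 1 \<longleftrightarrow> (\<forall>A\<in>sets (borel_of (mtopology_of Y)).
      (\<integral>z. f i z * indicator A (snd z) \<partial>\<xi> i) = (\<integral>z. f 1 z * indicator A (snd z) \<partial>\<xi> 1))"
    if i: "i \<in> {1..p}" for i
  proof -
    have "0 \<le> (\<integral>z. f 1 z * indicator A (snd z) \<partial>\<xi> 1)" for A
      using fD(1)[OF one] by (intro Bochner_Integration.integral_nonneg) auto
    then have meas: "measure (\<mu> 1) A = (\<integral>z. f 1 z * indicator A (snd z) \<partial>\<xi> 1)"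
      if "A \<in> sets (borel_of (mtopology_of Y))" for A
      using emeasure_distr_density[OF fD(2)[OF one] fD(1)[OF one] measurable_snd_\<xi> that]
      by (simp add: measure_def \<mu>_def)
    have "\<mu> i = \<mu> 1 \<longleftrightarrow> (\<forall>A\<in>sets (borel_of (mtopology_of Y)).
        (\<integral>z. f i z * indicator A (snd z) \<partial>\<xi> i) = measure (\<mu> 1) A)"
      unfolding \<mu>_def[of i] using \<mu>[OF one]
      by (intro distr_density_eq_iff fD(1,2)[OF i] measurable_snd_\<xi>)
        (auto simp: borel_probs_def prob_space_def)
    then show ?thesis using meas by simp
  qed
  have "?L \<longleftrightarrow> (\<exists>\<mu>'\<in>borel_probs (mtopology_of Y). \<forall>i\<in>{1..p}.
      distr (density (\<xi> i) (\<lambda>z. ennreal (f i z))) (borel_of (mtopology_of (X i))) fst = \<nu> i \<and> \<mu> i = \<mu>')"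
    using prob sets_\<xi>
    by (auto simp: feasible_def plans_def couplings_def borel_probs_def \<mu>_def PiE_iff)
  also have "\<dots> \<longleftrightarrow> (\<forall>i\<in>{1..p}. distr (density (\<xi> i) (\<lambda>z. ennreal (f i z)))
      (borel_of (mtopology_of (X i))) fst = \<nu> i) \<and> (\<forall>i\<in>{1..p}. \<mu> i = \<mu> 1)"
    using \<mu>[OF one] one by metis
  also have "\<dots> \<longleftrightarrow> ?P \<and> ?Q" using fst snd by simp
  finally show ?thesis .
qed

text \<open>Density 1 gives the product couplings \<open>\<xi> i\<close>, which all have second
  marginal \<eta> and zero entropy.\<close>

lemma K_nonempty: "(\<lambda>i z. 1) \<in> K"
proof -
  have dens: "\<forall>i\<in>{1..p}. entropic_density (\<xi> i) (\<lambda>z. 1)"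
  proof
    fix i assume "i \<in> {1..p}"
    then interpret prob_space "\<xi> i" by (rule prob_space_\<xi>)
    show "entropic_density (\<xi> i) (\<lambda>z. 1)" by (simp add: entropic_density_def ent_def prob_space)
  qed
  have fst: "(\<integral>z. 1 * indicator A (fst z) \<partial>\<xi> i) = measure (\<nu> i) A"
    if i: "i \<in> {1..p}" and A: "A \<in> sets (\<nu> i)" for i A
  proof -
    interpret \<nu>: prob_space "\<nu> i" by (rule prob_space_\<nu>[OF i])
    interpret \<eta>: prob_space \<eta> by (rule prob_space_\<eta>)
    have "(\<integral>z. 1 * indicator A (fst z) \<partial>\<xi> i) = (\<integral>z. (indicator (A \<times> space \<eta>) z :: real) \<partial>\<xi> i)"
      by (intro Bochner_Integration.integral_cong) (auto simp: \<xi>_def space_pair_measure indicator_def)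
    also have "\<dots> = measure (\<xi> i) (A \<times> space \<eta>)"
      using sets.sets_into_space[OF A] by (simp add: \<xi>_def space_pair_measure Int_absorb2 Sigma_mono)
    also have "\<dots> = measure (\<nu> i) A"
      using A by (simp add: \<xi>_def measure_def \<eta>.emeasure_pair_measure_Times \<eta>.emeasure_space_1)
    finally show ?thesis .
  qed
  have snd: "(\<integral>z. 1 * indicator A (snd z) \<partial>\<xi> i) = measure \<eta> A"
    if i: "i \<in> {1..p}" and A: "A \<in> sets \<eta>" for i A
  proof -
    interpret \<nu>: prob_space "\<nu> i" by (rule prob_space_\<nu>[OF i])
    interpret \<eta>: prob_space \<eta> by (rule prob_space_\<eta>)
    have "(\<integral>z. 1 * indicator A (snd z) \<partial>\<xi> i) = (\<integral>z. (indicator (space (\<nu> i) \<times> A) z :: real) \<partial>\<xi> i)"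
      by (intro Bochner_Integration.integral_cong) (auto simp: \<xi>_def space_pair_measure indicator_def)
    also have "\<dots> = measure (\<xi> i) (space (\<nu> i) \<times> A)"
      using sets.sets_into_space[OF A] by (simp add: \<xi>_def space_pair_measure Int_absorb2 Sigma_mono)
    also have "\<dots> = measure \<eta> A"
      using A by (simp add: \<xi>_def measure_def \<eta>.emeasure_pair_measure_Times \<nu>.emeasure_space_1)
    finally show ?thesis .
  qed
  have "plans (\<lambda>i z. 1) \<in> feasible p X Y \<nu>"
    using fst snd[unfolded sets_\<eta>] p_pos sets_\<nu> by (subst plans_feasible_iff) (use dens in auto)
  then show ?thesis using dens by (simp add: K_def)
qed

lemma K_midpoint:
  assumes f: "f \<in> K" and g: "g \<in> K"
  shows "(\<lambda>i x. (f i x + g i x) / 2) \<in> K"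
proof -
  have fd: "\<forall>i\<in>{1..p}. entropic_density (\<xi> i) (f i)"
    and gd: "\<forall>i\<in>{1..p}. entropic_density (\<xi> i) (g i)"
    using f g by (auto simp: K_def)
  have hd: "\<forall>i\<in>{1..p}. entropic_density (\<xi> i) (\<lambda>x. (f i x + g i x) / 2)"
    using fd gd prob_space_\<xi> by (auto intro!: entropic_density_midpoint simp: prob_space_def)
  have split: "(\<integral>z. (f i z + g i z) / 2 * indicator A (h z) \<partial>\<xi> i)
      = ((\<integral>z. f i z * indicator A (h z) \<partial>\<xi> i) + (\<integral>z. g i z * indicator A (h z) \<partial>\<xi> i)) / 2"
    if i: "i \<in> {1..p}" and h: "h \<in> measurable (\<xi> i) S" and A: "A \<in> sets S" for i A S
      and h :: "'a \<times> 'b \<Rightarrow> 'd"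
  proof -
    note [measurable] = h A
    have int: "integrable (\<xi> i) (\<lambda>z. u z * indicator A (h z))" if u: "integrable (\<xi> i) u"
      for u :: "'a \<times> 'b \<Rightarrow> real"
    proof -
      have [measurable]: "u \<in> borel_measurable (\<xi> i)" using u by auto
      show ?thesis
        by (rule Bochner_Integration.integrable_bound[OF u]) (auto simp: indicator_def)
    qed
    have "(\<integral>z. (f i z + g i z) / 2 * indicator A (h z) \<partial>\<xi> i)
        = (\<integral>z. (f i z * indicator A (h z) + g i z * indicator A (h z)) / 2 \<partial>\<xi> i)"
      by (simp add: distrib_right)
    then show ?thesis
      using int[OF entropic_densityD(2)[OF bspec[OF fd i]]] int[OF entropic_densityD(2)[OF bspec[OF gd i]]]
      by simp
  qed
  have one: "1 \<in> {1..p}" using p_pos by simp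
  have F: "plans f \<in> feasible p X Y \<nu>" and G: "plans g \<in> feasible p X Y \<nu>"
    using f g by (auto simp: K_def)
  note F = iffD1[OF plans_feasible_iff[OF fd] F] and G = iffD1[OF plans_feasible_iff[OF gd] G]
  note fst_f = conjunct1[OF F, rule_format] and snd_f = conjunct2[OF F, rule_format]
    and fst_g = conjunct1[OF G, rule_format] and snd_g = conjunct2[OF G, rule_format]
  have "plans (\<lambda>i x. (f i x + g i x) / 2) \<in> feasible p X Y \<nu>"
    unfolding plans_feasible_iff[OF hd]
  proof (intro conjI ballI)
    fix i A assume i: "i \<in> {1..p}" and A: "A \<in> sets (borel_of (mtopology_of (X i)))"
    show "(\<integral>z. (f i z + g i z) / 2 * indicator A (fst z) \<partial>\<xi> i) = measure (\<nu> i) A"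
      unfolding split[OF i measurable_fst_\<xi>[OF i] A] fst_f[OF i A] fst_g[OF i A] by simp
  next
    fix i A assume i: "i \<in> {1..p}" and A: "A \<in> sets (borel_of (mtopology_of Y))"
    show "(\<integral>z. (f i z + g i z) / 2 * indicator A (snd z) \<partial>\<xi> i)
        = (\<integral>z. (f 1 z + g 1 z) / 2 * indicator A (snd z) \<partial>\<xi> 1)"
      unfolding split[OF i measurable_snd_\<xi> A] split[OF one measurable_snd_\<xi> A]
        snd_f[OF i A] snd_g[OF i A] ..
  qed
  then show ?thesis using hd by (simp add: K_def)
qed

text \<open>For each fixed measurable set both sides of a constraint converge, so the equation
  survives by uniqueness of limits.\<close>

lemma K_L1_closed:
  assumes F: "\<And>n. F n \<in> K" and f: "\<forall>i\<in>{1..p}. entropic_density (\<xi> i) (f i)"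
    and lim: "\<And>i. i \<in> {1..p} \<Longrightarrow> (\<lambda>n. \<integral>x. \<bar>F n i x - f i x\<bar> \<partial>\<xi> i) \<longlonglongrightarrow> 0"
  shows "f \<in> K"
proof -
  have Fd: "\<forall>i\<in>{1..p}. entropic_density (\<xi> i) (F n i)" for n
    using F by (auto simp: K_def)
  have "plans (F n) \<in> feasible p X Y \<nu>" for n using F by (auto simp: K_def)
  note Ff = iffD1[OF plans_feasible_iff[OF Fd] this]
  note fst_F = conjunct1[OF Ff, rule_format] and snd_F = conjunct2[OF Ff, rule_format]
  have conv: "(\<lambda>n. \<integral>z. F n i z * indicator A (h z) \<partial>\<xi> i) \<longlonglongrightarrow> (\<integral>z. f i z * indicator A (h z) \<partial>\<xi> i)"
    if i: "i \<in> {1..p}" and h: "h \<in> measurable (\<xi> i) S" and A: "A \<in> sets S" for i A S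
      and h :: "'a \<times> 'b \<Rightarrow> 'd"
    by (rule tendsto_integral_indicator_L1[OF entropic_densityD(2)[OF bspec[OF Fd i]]
      entropic_densityD(2)[OF bspec[OF f i]] lim[OF i] h A])
  have one: "1 \<in> {1..p}" using p_pos by simp
  have "plans f \<in> feasible p X Y \<nu>"
    unfolding plans_feasible_iff[OF f]
  proof (intro conjI ballI)
    fix i A assume i: "i \<in> {1..p}" and A: "A \<in> sets (borel_of (mtopology_of (X i)))"
    show "(\<integral>z. f i z * indicator A (fst z) \<partial>\<xi> i) = measure (\<nu> i) A"
      by (rule LIMSEQ_unique[OF conv[OF i measurable_fst_\<xi>[OF i] A]])
        (simp only: fst_F[OF i A] tendsto_const)
  next
    fix i A assume i: "i \<in> {1..p}" and A: "A \<in> sets (borel_of (mtopology_of Y))"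
    show "(\<integral>z. f i z * indicator A (snd z) \<partial>\<xi> i) = (\<integral>z. f 1 z * indicator A (snd z) \<partial>\<xi> 1)"
      using conv[OF i measurable_snd_\<xi> A, unfolded snd_F[OF i A]] conv[OF one measurable_snd_\<xi> A]
      by (rule LIMSEQ_unique)
  qed
  then show ?thesis using f by (simp add: K_def)
qed

text \<open>A bound has to be fixed as a term so that it can be passed as a parameter to
  \<open>entropy_minimization\<close>.\<close>

definition c_bound :: real where
  "c_bound = (SOME B. \<forall>i\<in>{1..p}. \<forall>x\<in>space (\<xi> i). \<bar>c i x\<bar> \<le> B)"

lemma abs_c_le: "i \<in> {1..p} \<Longrightarrow> x \<in> space (\<xi> i) \<Longrightarrow> \<bar>c i x\<bar> \<le> c_bound"
  using someI_ex[OF c_bounded] unfolding c_bound_def by blast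

sublocale entropy_minimization "{1..p}" \<xi> c lam \<epsilon> c_bound K
proof (rule entropy_minimization.intro)
  show "entropic_density (\<xi> i) (f i)" if "f \<in> K" "i \<in> {1..p}" for f i
    using that by (simp add: K_def)
  show "f \<in> K" if "\<And>n. F n \<in> K" "\<And>i. i \<in> {1..p} \<Longrightarrow> entropic_density (\<xi> i) (f i)"
    "\<And>i. i \<in> {1..p} \<Longrightarrow> (\<lambda>n. \<integral>x. \<bar>F n i x - f i x\<bar> \<partial>\<xi> i) \<longlonglongrightarrow> 0" for F f
    using that by (intro K_L1_closed[of F f]) simp_all
qed (simp_all add: \<epsilon>_pos prob_space_\<xi> measurable_c abs_c_le lam_pos K_midpoint)

section \<open>From densities back to tuples of couplings\<close>

lemma objective_plans:
  assumes f: "f \<in> K"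
  shows "objective p \<epsilon> lam c \<nu> \<eta> (plans f) = ereal (J f)"
proof -
  have "objective p \<epsilon> lam c \<nu> \<eta> (plans f) = (\<Sum>i=1..p. ereal (lam i * cost i (f i)))"
    unfolding objective_def
  proof (rule sum.cong[OF refl])
    fix i assume i: "i \<in> {1..p}"
    note fD = entropic_densityD[OF dens[OF f i]]
    have "(\<integral>z. c i z \<partial>plans f i) = (\<integral>z. c i z * f i z \<partial>\<xi> i)"
      using i fD measurable_c[OF i] by (simp add: plans_def integral_density mult.commute)
    moreover have "KL (plans f i) (\<nu> i \<Otimes>\<^sub>M \<eta>) = ereal (\<integral>z. ent (f i z) \<partial>\<xi> i)"
      using KL_density[OF prob_space_\<xi>[OF i] fD(5,1)] fD(4) i by (simp add: plans_def \<xi>_def)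
    ultimately show "ereal (lam i) * (ereal (\<integral>z. c i z \<partial>plans f i) + ereal \<epsilon> * KL (plans f i) (\<nu> i \<Otimes>\<^sub>M \<eta>))
        = ereal (lam i * cost i (f i))"
      by (simp add: cost_def)
  qed
  also have "\<dots> = ereal (J f)" unfolding J_def by (rule sum_ereal)
  finally show ?thesis .
qed

text \<open>Finite value forces every relative entropy to be finite, hence absolute continuity and
  an integrable entropy in every coordinate.\<close>

lemma finite_objective_density:
  assumes \<gamma>: "\<gamma> \<in> feasible p X Y \<nu>" and fin: "objective p \<epsilon> lam c \<nu> \<eta> \<gamma> \<noteq> \<infinity>"
  obtains f where "f \<in> K" "\<gamma> = plans f"
proof -
  have \<gamma>i: "prob_space (\<gamma> i)" "sets (\<gamma> i) = sets (\<xi> i)" if "i \<in> {1..p}" for i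
    using \<gamma> that sets_\<xi>[OF that]
    by (auto simp: feasible_def couplings_def borel_probs_def PiE_iff)
  have "\<exists>f. entropic_density (\<xi> i) f \<and> \<gamma> i = density (\<xi> i) (\<lambda>z. ennreal (f z))"
    if i: "i \<in> {1..p}" for i
  proof -
    have KL: "KL (\<gamma> i) (\<xi> i) \<noteq> \<infinity>"
    proof
      assume "KL (\<gamma> i) (\<xi> i) = \<infinity>"
      \<comment> \<open>The transport term is a real number and both \<open>lam i\<close> and
        \<epsilon> are positive, so the summand is infinite. In \<open>ereal\<close> one summand
        \<open>\<infinity>\<close> makes the whole sum \<open>\<infinity>\<close>.\<close>
      then have "ereal (lam i) * (ereal (\<integral>z. c i z \<partial>\<gamma> i) + ereal \<epsilon> * KL (\<gamma> i) (\<nu> i \<Otimes>\<^sub>M \<eta>)) = \<infinity>"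
        using lam_pos[OF i] \<epsilon>_pos by (simp add: \<xi>_def)
      then have "objective p \<epsilon> lam c \<nu> \<eta> \<gamma> = \<infinity>"
        unfolding objective_def sum_Pinfty using i by blast
      then show False using fin by simp
    qed
    then have ac: "absolutely_continuous (\<xi> i) (\<gamma> i)" by (auto simp: KL_def split: if_splits)
    obtain f where f: "f \<in> borel_measurable (\<xi> i)" "\<forall>z. 0 \<le> f z"
      "\<gamma> i = density (\<xi> i) (\<lambda>z. ennreal (f z))" "integrable (\<xi> i) f" "(\<integral>z. f z \<partial>\<xi> i) = 1"
      by (rule ex_real_density[OF prob_space_\<xi>[OF i] \<gamma>i(1)[OF i] ac \<gamma>i(2)[OF i]])
    have "integrable (\<xi> i) (\<lambda>z. ent (f z))"
      using KL KL_density[OF prob_space_\<xi>[OF i] f(1) f(2)[rule_format]] f(3) by (simp split: if_splits)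
    then show ?thesis using f unfolding entropic_density_def by blast
  qed
  then have "\<forall>i\<in>{1..p}. \<exists>f. entropic_density (\<xi> i) f \<and> \<gamma> i = density (\<xi> i) (\<lambda>z. ennreal (f z))"
    by blast
  from bchoice[OF this] obtain f where
    f: "\<forall>i\<in>{1..p}. entropic_density (\<xi> i) (f i) \<and> \<gamma> i = density (\<xi> i) (\<lambda>z. ennreal (f i z))"
    by blast
  have "\<gamma> \<in> extensional {1..p}" using \<gamma> by (auto simp: feasible_def PiE_iff)
  then have eq: "\<gamma> = plans f"
    by (rule extensionalityI[of _ "{1..p}"]) (use f in \<open>simp_all add: plans_def\<close>)
  then have "f \<in> K" using f \<gamma> by (simp add: K_def)
  then show ?thesis using eq that by blast
qed

text \<open>Feasible tuples that do not come from \<open>K\<close> have value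
  \<open>\<infinity>\<close>, so comparing within \<open>K\<close> is enough.\<close>

lemma optimal_plans_iff:
  assumes "f \<in> K"
  shows "optimal p \<epsilon> X Y lam c \<nu> \<eta> (plans f) \<longleftrightarrow> (\<forall>g\<in>K. J f \<le> J g)"
proof
  assume opt: "optimal p \<epsilon> X Y lam c \<nu> \<eta> (plans f)"
  show "\<forall>g\<in>K. J f \<le> J g"
  proof
    fix g assume g: "g \<in> K"
    then have "plans g \<in> feasible p X Y \<nu>" by (simp add: K_def)
    then have "objective p \<epsilon> lam c \<nu> \<eta> (plans f) \<le> objective p \<epsilon> lam c \<nu> \<eta> (plans g)"
      using opt by (simp add: optimal_def)
    then show "J f \<le> J g" by (simp add: objective_plans assms g)
  qed
next
  assume le: "\<forall>g\<in>K. J f \<le> J g"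
  show "optimal p \<epsilon> X Y lam c \<nu> \<eta> (plans f)"
    unfolding optimal_def
  proof (intro conjI ballI)
    show "plans f \<in> feasible p X Y \<nu>" using assms by (simp add: K_def)
    fix \<gamma> assume \<gamma>: "\<gamma> \<in> feasible p X Y \<nu>"
    show "objective p \<epsilon> lam c \<nu> \<eta> (plans f) \<le> objective p \<epsilon> lam c \<nu> \<eta> \<gamma>"
    proof (cases "objective p \<epsilon> lam c \<nu> \<eta> \<gamma> = \<infinity>")
      case False
      then obtain g where "g \<in> K" "\<gamma> = plans g" by (rule finite_objective_density[OF \<gamma>])
      then show ?thesis using le assms by (simp add: objective_plans)
    qed simp
  qed
qed

lemma ex1_optimal: "\<exists>!\<gamma>. optimal p \<epsilon> X Y lam c \<nu> \<eta> \<gamma>"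
proof -
  obtain f where f: "f \<in> K" "\<And>g. g \<in> K \<Longrightarrow> J f \<le> J g"
    using minimizer_exists K_nonempty by blast
  have opt: "optimal p \<epsilon> X Y lam c \<nu> \<eta> (plans f)" using f by (simp add: optimal_plans_iff)
  have "\<gamma> = plans f" if \<gamma>: "optimal p \<epsilon> X Y lam c \<nu> \<eta> \<gamma>" for \<gamma>
  proof -
    have "objective p \<epsilon> lam c \<nu> \<eta> \<gamma> \<le> objective p \<epsilon> lam c \<nu> \<eta> (plans f)"
      using \<gamma> opt by (simp add: optimal_def)
    \<comment> \<open>The value of \<open>plans f\<close> is real, so the other optimal tuple is
      also given by densities and \<open>minimizer_unique\<close> becomes applicable.\<close>
    then have "objective p \<epsilon> lam c \<nu> \<eta> \<gamma> \<noteq> \<infinity>" by (auto simp: objective_plans f(1))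
    then obtain g where g: "g \<in> K" "\<gamma> = plans g"
      using \<gamma> finite_objective_density unfolding optimal_def by metis
    have AE_eq: "AE z in \<xi> i. g i z = f i z" if "i \<in> {1..p}" for i
      using \<gamma> g f that by (intro minimizer_unique) (auto simp: optimal_plans_iff)
    \<comment> \<open>Almost everywhere equality of densities becomes genuine equality of
      measures.\<close>
    have "density (\<xi> i) (\<lambda>z. ennreal (g i z)) = density (\<xi> i) (\<lambda>z. ennreal (f i z))"
      if i: "i \<in> {1..p}" for i
      using entropic_densityD(5)[OF dens[OF g(1) i]] entropic_densityD(5)[OF dens[OF f(1) i]] AE_eq[OF i]
      by (intro density_cong) auto
    then show ?thesis unfolding g(2) plans_def by (rule restrict_ext)
  qed
  then show ?thesis using opt by blast
qed

end

theorem theorem3p3: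
  fixes p :: nat
    and \<epsilon> :: real
    and X :: "nat \<Rightarrow> 'a metric"
    and Y :: "'b metric"
    and lam :: "nat \<Rightarrow> real"
    and c :: "nat \<Rightarrow> 'a \<times> 'b \<Rightarrow> real"
    and \<nu> :: "nat \<Rightarrow> 'a measure"
    and \<eta> :: "'b measure"
  assumes "p \<ge> 2"
    and "\<epsilon> > 0"
    and "\<And>i. i \<in> {1..p} \<Longrightarrow> compact_space (mtopology_of (X i))"
    and "compact_space (mtopology_of Y)"
    and "\<And>i. i \<in> {1..p} \<Longrightarrow> \<nu> i \<in> borel_probs (mtopology_of (X i))"
    and "\<And>i. i \<in> {1..p} \<Longrightarrow>
           continuous_map (prod_topology (mtopology_of (X i)) (mtopology_of Y)) euclideanreal (c i)"
    and "\<And>i. i \<in> {1..p} \<Longrightarrow> lam i > 0"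
    and "(\<Sum>i = 1..p. lam i) = 1"
    and "\<eta> \<in> borel_probs (mtopology_of Y)"
    and "\<And>i. i \<in> {1..p} \<Longrightarrow> spt (mtopology_of (X i)) (\<nu> i) = mspace (X i)"
    and "spt (mtopology_of Y) \<eta> = mspace Y"
  shows "\<exists>\<gamma>\<^sub>\<epsilon> \<nu>\<^sub>\<epsilon>.
           optimal p \<epsilon> X Y lam c \<nu> \<eta> \<gamma>\<^sub>\<epsilon> \<and>
           (\<forall>\<gamma>. optimal p \<epsilon> X Y lam c \<nu> \<eta> \<gamma> \<longrightarrow> \<gamma> = \<gamma>\<^sub>\<epsilon>) \<and>
           common_snd_marginal p Y \<gamma>\<^sub>\<epsilon> \<nu>\<^sub>\<epsilon> \<and>
           barycenter p \<epsilon> X Y lam c \<nu> \<eta> \<nu>\<^sub>\<epsilon> \<and>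
           (\<forall>\<mu>. barycenter p \<epsilon> X Y lam c \<nu> \<eta> \<mu> \<longrightarrow> \<mu> = \<nu>\<^sub>\<epsilon>)"
proof -
  have "1 \<le> p" using assms(1) by simp
  then interpret entropic_barycenter p \<epsilon> X Y lam c \<nu> \<eta>
    by (rule entropic_barycenter.intro) (fact assms)+
  obtain \<gamma> where \<gamma>: "optimal p \<epsilon> X Y lam c \<nu> \<eta> \<gamma>"
    and unique: "\<forall>\<gamma>'. optimal p \<epsilon> X Y lam c \<nu> \<eta> \<gamma>' \<longrightarrow> \<gamma>' = \<gamma>"
    by (rule ex1E[OF ex1_optimal])
  from \<gamma> obtain \<mu> where \<mu>: "\<mu> \<in> borel_probs (mtopology_of Y)"
    and couplings: "\<gamma> \<in> (\<Pi>\<^sub>E i \<in> {1..p}. couplings (mtopology_of (X i)) (mtopology_of Y) (\<nu> i) \<mu>)"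
    unfolding optimal_def feasible_def by blast
  have marginal: "common_snd_marginal p Y \<gamma> \<mu>"
    unfolding common_snd_marginal_def using PiE_mem[OF couplings] by (simp add: couplings_def)
  have "\<mu>' = \<mu>" if "barycenter p \<epsilon> X Y lam c \<nu> \<eta> \<mu>'" for \<mu>'
  proof -
    obtain \<gamma>' where "optimal p \<epsilon> X Y lam c \<nu> \<eta> \<gamma>'" "common_snd_marginal p Y \<gamma>' \<mu>'"
      using \<open>barycenter p \<epsilon> X Y lam c \<nu> \<eta> \<mu>'\<close> unfolding barycenter_def by blast
    then have "common_snd_marginal p Y \<gamma> \<mu>'" using unique by simp
    \<comment> \<open>Both measures are the second marginal of the same \<open>\<gamma> i\<close>;
      \<open>p_pos\<close> guarantees that such an index exists.\<close>
    then show ?thesis using marginal p_pos unfolding common_snd_marginal_def by force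
  qed
  moreover have "barycenter p \<epsilon> X Y lam c \<nu> \<eta> \<mu>"
    using \<mu> \<gamma> marginal by (auto simp: barycenter_def)
  ultimately show ?thesis using \<gamma> unique marginal by blast
qed

end
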